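(* Let $p\in(1,+\infty)$ and let $V\colon\mathbb{R}^2\to\mathbb{R}$ be a $C^1$ positive coercive function with $|\nabla V(x)|\le CV^{3/2}(x)$ for a.e. $x$ and some $C>0$. Let \[ I(u)=\frac12\int_{\mathbb{R}^2}(|\nabla u|^2+V(x)u^2)\,dx-\frac1{p+1}\|u\|_2^2\int_{\mathbb{R}^2}V(x)|u|^{p+1}dx,\qquad u\in H^1_V(\mathbb{R}^2), \] \[ \mathcal N=\Big\{u\in H^1_V(\mathbb{R}^2): u\ne0,\ \int_{\mathbb{R}^2}(|\nabla u|^2+V(x)u^2)\,dx=\frac{p+3}{p+1}\|u\|_2^2\int_{\mathbb{R}^2}V(x)|u|^{p+1}dx\Big\}, \] and $\sigma=\inf_{\mathcal N}I$. If $\{u_n\}_n\subset\mathcal N$ satisfies $I(u_n)\to\sigma$, then, up to a subsequence, there exists $u_0\in H^1_V(\mathbb{R}^2)\setminus\{0\}$ such that $u_n\rightharpoonup u_0$ weakly in $H^1_V(\mathbb{R}^2)$.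
   Context: $H^1_V(\mathbb{R}^2)$ is the completion of $C_0^\infty(\mathbb{R}^2)$ with respect to the norm $\|u\|_V=\left(\int_{\mathbb{R}^2}(|\nabla u|^2+V|u|^2)\,dx\right)^{1/2}$; $\|\cdot\|_2$ is the $L^2$ norm. *)

theory Defs
  imports "HOL-Analysis.Analysis"
begin

type_synonym pt = "real^2"

definition grad :: "(pt \<Rightarrow> real) \<Rightarrow> pt \<Rightarrow> pt" where
  "grad f x = (\<chi> i. frechet_derivative f (at x) (axis i 1))"

fun Ck :: "nat \<Rightarrow> (pt \<Rightarrow> real) set" where
  "Ck 0 = {f. continuous_on UNIV f}"
| "Ck (Suc k) = {f. continuous_on UNIV f \<and>
      (\<exists>Df. (\<forall>x. (f has_derivative (\<lambda>h. Df x \<bullet> h)) (at x)) \<and>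
            (\<forall>i. (\<lambda>x. Df x $ i) \<in> Ck k))}"

definition smooth :: "(pt \<Rightarrow> real) set" where
  "smooth = (\<Inter>k. Ck k)"

definition test_fun :: "(pt \<Rightarrow> real) set" where
  "test_fun = {f. f \<in> smooth \<and> compact (closure {x. f x \<noteq> 0})}"

text \<open>Elements of H^1_V are represented as pairs (u, g) of a function and its
  (weak) gradient which are limits, in the norm
  (\<integral> |\<nabla>u|^2 + V u^2)^(1/2), of test functions and their gradients.
  This is the concrete realisation of the completion of C_0^infinity.\<close>
definition H1V :: "(pt \<Rightarrow> real) \<Rightarrow> ((pt \<Rightarrow> real) \<times> (pt \<Rightarrow> pt)) set" where
  "H1V V = {(u, g). u \<in> borel_measurable lborel \<and> g \<in> borel_measurable lborel \<and>
     (\<exists>\<phi>. (\<forall>n. \<phi> n \<in> test_fun) \<and>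
        (\<lambda>n. \<integral>\<^sup>+ x. ennreal ((norm (g x - grad (\<phi> n) x))\<^sup>2 + V x * (u x - \<phi> n x)\<^sup>2) \<partial>lborel)
          \<longlonglongrightarrow> 0)}"

definition innerV :: "(pt \<Rightarrow> real) \<Rightarrow> (pt \<Rightarrow> real) \<times> (pt \<Rightarrow> pt) \<Rightarrow> (pt \<Rightarrow> real) \<times> (pt \<Rightarrow> pt) \<Rightarrow> real" where
  "innerV V v w = (\<integral>x. snd v x \<bullet> snd w x + V x * fst v x * fst w x \<partial>lborel)"

definition normV_sq :: "(pt \<Rightarrow> real) \<Rightarrow> (pt \<Rightarrow> real) \<times> (pt \<Rightarrow> pt) \<Rightarrow> real" where
  "normV_sq V v = innerV V v v"

definition L2_sq :: "(pt \<Rightarrow> real) \<Rightarrow> real" where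
  "L2_sq u = (\<integral>x. (u x)\<^sup>2 \<partial>lborel)"

definition nonlin :: "real \<Rightarrow> (pt \<Rightarrow> real) \<Rightarrow> (pt \<Rightarrow> real) \<Rightarrow> real" where
  "nonlin p V u = (\<integral>x. V x * \<bar>u x\<bar> powr (p + 1) \<partial>lborel)"

definition Ifun :: "real \<Rightarrow> (pt \<Rightarrow> real) \<Rightarrow> (pt \<Rightarrow> real) \<times> (pt \<Rightarrow> pt) \<Rightarrow> real" where
  "Ifun p V v = 1/2 * normV_sq V v - 1 / (p + 1) * L2_sq (fst v) * nonlin p V (fst v)"

definition nonzeroV :: "(pt \<Rightarrow> real) \<times> (pt \<Rightarrow> pt) \<Rightarrow> bool" where
  "nonzeroV v \<longleftrightarrow> \<not> (AE x in lborel. fst v x = 0)"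

definition Nehari :: "real \<Rightarrow> (pt \<Rightarrow> real) \<Rightarrow> ((pt \<Rightarrow> real) \<times> (pt \<Rightarrow> pt)) set" where
  "Nehari p V = {v \<in> H1V V. nonzeroV v \<and>
     normV_sq V v = (p + 3) / (p + 1) * L2_sq (fst v) * nonlin p V (fst v)}"

definition weak_conv_V :: "(pt \<Rightarrow> real) \<Rightarrow> (nat \<Rightarrow> (pt \<Rightarrow> real) \<times> (pt \<Rightarrow> pt)) \<Rightarrow> (pt \<Rightarrow> real) \<times> (pt \<Rightarrow> pt) \<Rightarrow> bool" where
  "weak_conv_V V s v \<longleftrightarrow> (\<forall>w \<in> H1V V. (\<lambda>n. innerV V (s n) w) \<longlonglongrightarrow> innerV V v w)"

end

theory Submission
  imports Defs "HOL-Complex_Analysis.Great_Picard"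
begin

text \<open>On the Nehari set \<open>I(u) = (1/2 - 1/(p+3)) \<parallel>u\<parallel>\<^sub>V\<^sup>2\<close>, so a minimising sequence is bounded in the
  Hilbert space \<open>H\<^sup>1\<^sub>V\<close> and has a weakly convergent subsequence. The Gagliardo--Nirenberg inequality
  \<open>\<parallel>w\<parallel>\<^sub>2 \<le> \<parallel>\<nabla>w\<parallel>\<^sub>1\<close> in the plane, applied to \<open>w = \<surd>V u\<^sup>k\<close> for \<open>k = 2, 3, \<dots>\<close>, bounds \<open>\<integral>V|u|\<^bsup>2k\<^esup>\<close>
  by a multiple of \<open>\<parallel>u\<parallel>\<^sub>V\<^bsup>2k\<^esup>\<close>, hence \<open>\<integral>V|u|\<^bsup>p+1\<^esup>\<close> by a multiple of \<open>\<parallel>u\<parallel>\<^sub>V\<^sup>2\<close> on bounded sets; with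
  the Nehari identity this keeps \<open>\<parallel>u\<^sub>n\<parallel>\<^sub>2\<close> away from zero. Since \<open>V\<close> is coercive, \<open>H\<^sup>1\<^sub>V\<close> embeds compactly
  into \<open>L\<^sup>2\<close>, so the weak limit cannot vanish.\<close>

section \<open>Weak sequential compactness in Hilbert spaces\<close>

lemma subspace_closure:
  fixes S :: "'a::real_normed_vector set"
  assumes S: "subspace S"
  shows "subspace (closure S)"
proof (rule subspaceI)
  show "0 \<in> closure S" using subspace_0[OF S] closure_subset by blast
  show "x + y \<in> closure S" if xy: "x \<in> closure S" "y \<in> closure S" for x y
  proof -
    obtain a b where "\<forall>n. a n \<in> S" "a \<longlonglongrightarrow> x" "\<forall>n. b n \<in> S" "b \<longlonglongrightarrow> y"
      using xy unfolding closure_sequential by blast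
    then show ?thesis
      unfolding closure_sequential by (intro exI[of _ "\<lambda>n. a n + b n"])
        (simp add: tendsto_add subspace_add[OF S])
  qed
  show "c *\<^sub>R x \<in> closure S" if x: "x \<in> closure S" for c x
  proof -
    obtain a where "\<forall>n. a n \<in> S" "a \<longlonglongrightarrow> x" using x unfolding closure_sequential by blast
    then show ?thesis
      unfolding closure_sequential
      by (intro exI[of _ "\<lambda>n. c *\<^sub>R a n"]) (simp add: tendsto_scaleR subspace_scale[OF S])
  qed
qed

lemma linear_coeff_eq_0_if_quadratic_nonneg:
  fixes a b :: real
  assumes nonneg: "\<And>t. 0 \<le> t\<^sup>2 * a + 2 * t * b"
  shows "b = 0"
proof -
  have "a \<ge> 0" using nonneg[of 1] nonneg[of "-1"] by simp
  then have "0 \<le> (b / (a + 1))\<^sup>2 * a - 2 * (b / (a + 1)) * b"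
    using nonneg[of "- (b / (a + 1))"] by simp
  also have "\<dots> = - (b\<^sup>2 * (a + 2) / (a + 1)\<^sup>2)"
    using \<open>a \<ge> 0\<close> by (simp add: divide_simps) (simp add: algebra_simps power2_eq_square)
  finally have "b\<^sup>2 * (a + 2) / (a + 1)\<^sup>2 \<le> 0" by simp
  with \<open>a \<ge> 0\<close> show ?thesis by (simp add: divide_le_0_iff mult_le_0_iff)
qed

locale bounded_functional_on_subspace =
  fixes S :: "'a::real_inner set" and l :: "'a \<Rightarrow> real" and B :: real
  assumes subspace: "subspace S"
    and add: "\<And>x y. x \<in> S \<Longrightarrow> y \<in> S \<Longrightarrow> l (x + y) = l x + l y"
    and scale: "\<And>c x. x \<in> S \<Longrightarrow> l (c *\<^sub>R x) = c * l x"
    and bound: "\<And>x. x \<in> S \<Longrightarrow> l x \<le> B * norm x"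
begin

definition energy :: "'a \<Rightarrow> real" where
  "energy x = x \<bullet> x - 2 * l x"

definition min_energy :: real where
  "min_energy = Inf (energy ` S)"

lemma bdd_below_energy: "bdd_below (energy ` S)"
proof (rule bdd_belowI2)
  fix x assume "x \<in> S"
  have "0 \<le> (norm x - B)\<^sup>2" by simp
  also have "\<dots> = x \<bullet> x - 2 * (B * norm x) + B\<^sup>2"
    by (simp add: power2_diff power2_norm_eq_inner)
  finally show "- (B\<^sup>2) \<le> energy x" using bound[OF \<open>x \<in> S\<close>] unfolding energy_def by linarith
qed

lemma min_energy_le: "x \<in> S \<Longrightarrow> min_energy \<le> energy x"
  unfolding min_energy_def by (intro cInf_lower bdd_below_energy) auto

lemma minimising_sequence_exists:
  obtains x where "\<And>n. x n \<in> S" "\<And>n. energy (x n) < min_energy + inverse (real (Suc n))"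
proof -
  have "\<exists>x\<in>S. energy x < min_energy + inverse (real (Suc n))" for n
    using cInf_lessD[of "energy ` S" "min_energy + inverse (real (Suc n))"] subspace_0[OF subspace]
    by (auto simp: min_energy_def)
  then show thesis using that by metis
qed

lemma minimising_sequence_Cauchy:
  assumes x: "\<And>n. x n \<in> S" and energy_x: "\<And>n. energy (x n) < min_energy + inverse (real (Suc n))"
  shows "Cauchy x"
proof (rule CauchyI)
  have parallelogram:
    "(norm (x i - x j))\<^sup>2 \<le> 2 * (energy (x i) - min_energy) + 2 * (energy (x j) - min_energy)" for i j
  proof -
    let ?mid = "(1/2) *\<^sub>R (x i + x j)"
    have "min_energy \<le> energy ?mid" using x subspace by (intro min_energy_le subspace_scale subspace_add)
    moreover have "l ?mid = (l (x i) + l (x j)) / 2"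
      using x subspace by (simp add: scale add subspace_add del: scaleR_add_right)
    ultimately show ?thesis
      unfolding energy_def by (simp add: power2_norm_eq_inner inner_simps inner_commute field_simps)
  qed
  fix e :: real assume "e > 0"
  then obtain N where N: "inverse (real (Suc N)) < e\<^sup>2 / 4"
    using reals_Archimedean[of "e\<^sup>2 / 4"] by auto
  have "norm (x i - x j) < e" if "N \<le> i" "N \<le> j" for i j
  proof (rule power2_less_imp_less)
    have "inverse (real (Suc i)) \<le> inverse (real (Suc N))"
        "inverse (real (Suc j)) \<le> inverse (real (Suc N))"
      using that by (simp_all add: le_imp_inverse_le)
    then show "(norm (x i - x j))\<^sup>2 < e\<^sup>2"
      using parallelogram[of i j] energy_x[of i] energy_x[of j] N by argo
  qed (use \<open>e > 0\<close> in simp)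
  then show "\<exists>N. \<forall>i\<ge>N. \<forall>j\<ge>N. norm (x i - x j) < e" by blast
qed

end

text \<open>A minimiser \<open>y\<close> of the energy represents \<open>l\<close>, because the first variation of the energy at \<open>y\<close> in
  the direction \<open>w\<close> is \<open>2 (\<langle>y, w\<rangle> - l(w))\<close>.\<close>

theorem Riesz_representation_on_closed_subspace:
  fixes S :: "'a::{real_inner, complete_space} set"
  assumes "bounded_functional_on_subspace S l B" and "closed S"
  obtains y where "y \<in> S" "\<And>w. w \<in> S \<Longrightarrow> y \<bullet> w = l w"
proof -
  interpret bounded_functional_on_subspace S l B by fact
  obtain x where x: "\<And>n. x n \<in> S" and energy_x: "\<And>n. energy (x n) < min_energy + inverse (real (Suc n))"
    using minimising_sequence_exists by blast
  then have "Cauchy x" by (rule minimising_sequence_Cauchy)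
  then obtain y where y: "x \<longlonglongrightarrow> y" using Cauchy_convergent convergent_def by blast
  have "y \<bullet> w - l w = 0" if w: "w \<in> S" for w
  proof (rule linear_coeff_eq_0_if_quadratic_nonneg, rule LIMSEQ_le_const)
    fix t
    have "(\<lambda>n. t\<^sup>2 * (w \<bullet> w) + 2 * t * (x n \<bullet> w - l w) + inverse (real (Suc n)))
        \<longlonglongrightarrow> t\<^sup>2 * (w \<bullet> w) + 2 * t * (y \<bullet> w - l w) + 0"
      by (intro tendsto_intros y LIMSEQ_inverse_real_of_nat)
    then show "(\<lambda>n. t\<^sup>2 * (w \<bullet> w) + 2 * t * (x n \<bullet> w - l w) + inverse (real (Suc n)))
        \<longlonglongrightarrow> t\<^sup>2 * (w \<bullet> w) + 2 * t * (y \<bullet> w - l w)" by simp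
    have "min_energy \<le> energy (x n + t *\<^sub>R w)" for n
      using x w subspace by (intro min_energy_le subspace_scale subspace_add)
    also have "energy (x n + t *\<^sub>R w) = energy (x n) + t\<^sup>2 * (w \<bullet> w) + 2 * t * (x n \<bullet> w - l w)" for n
      unfolding energy_def using x[of n] w subspace
      by (simp add: add scale subspace_scale inner_simps inner_commute power2_eq_square algebra_simps)
    finally show "\<exists>N. \<forall>n\<ge>N. 0 \<le> t\<^sup>2 * (w \<bullet> w) + 2 * t * (x n \<bullet> w - l w) + inverse (real (Suc n))"
      using energy_x by (smt (verit))
  qed
  moreover have "y \<in> S" using closed_sequentially[OF \<open>closed S\<close> _ y] x by blast
  ultimately show thesis using that by fastforce
qed

lemma orthogonal_projection_exists:
  fixes S :: "'a::{real_inner, complete_space} set"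
  assumes "subspace S" "closed S"
  obtains y where "y \<in> S" "\<And>w. w \<in> S \<Longrightarrow> y \<bullet> w = x \<bullet> w"
proof (rule Riesz_representation_on_closed_subspace[of S "\<lambda>w. x \<bullet> w" "norm x"])
  show "bounded_functional_on_subspace S (\<lambda>w. x \<bullet> w) (norm x)"
    using \<open>subspace S\<close> by unfold_locales (auto simp: inner_add_right norm_cauchy_schwarz)
qed (use \<open>closed S\<close> that in auto)

lemma closed_convergent_inner:
  fixes F :: "nat \<Rightarrow> 'a::real_inner"
  assumes bound: "\<And>n. norm (F n) \<le> K"
  shows "closed {w. convergent (\<lambda>n. F n \<bullet> w)}"
proof (rule closed_sequential_limits[THEN iffD2], intro allI impI, elim conjE)
  fix v w assume conv: "\<forall>i. v i \<in> {w. convergent (\<lambda>n. F n \<bullet> w)}" and lim: "v \<longlonglongrightarrow> w"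
  have "K \<ge> 0" using bound[of 0] norm_ge_zero order.trans by blast
  have "Cauchy (\<lambda>n. F n \<bullet> w)"
  proof (rule metric_CauchyI)
    fix e :: real assume "e > 0"
    then have "e / (3 * (K + 1)) > 0" using \<open>K \<ge> 0\<close> by simp
    then obtain i where "dist (v i) w < e / (3 * (K + 1))"
      using metric_LIMSEQ_D[OF lim] by blast
    then have dist_small: "norm (v i - w) * (K + 1) < e / 3"
      using \<open>K \<ge> 0\<close> by (simp add: dist_norm field_simps)
    have close: "\<bar>F n \<bullet> v i - F n \<bullet> w\<bar> < e / 3" for n
    proof -
      have "\<bar>F n \<bullet> v i - F n \<bullet> w\<bar> \<le> norm (F n) * norm (v i - w)"
        using Cauchy_Schwarz_ineq2[of "F n" "v i - w"] by (simp add: inner_diff_right)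
      also have "\<dots> \<le> (K + 1) * norm (v i - w)"
        using bound[of n] by (intro mult_right_mono) auto
      finally show ?thesis using dist_small by (simp add: mult.commute)
    qed
    have "Cauchy (\<lambda>n. F n \<bullet> v i)" using conv convergent_Cauchy by blast
    then obtain N where N: "\<And>m n. m \<ge> N \<Longrightarrow> n \<ge> N \<Longrightarrow> dist (F m \<bullet> v i) (F n \<bullet> v i) < e / 3"
      using metric_CauchyD[of "\<lambda>n. F n \<bullet> v i" "e / 3"] \<open>e > 0\<close> by fastforce
    have "dist (F m \<bullet> w) (F n \<bullet> w) < e" if "m \<ge> N" "n \<ge> N" for m n
      using N[OF that] close[of m] close[of n] unfolding dist_real_def by linarith
    then show "\<exists>N. \<forall>m\<ge>N. \<forall>n\<ge>N. dist (F m \<bullet> w) (F n \<bullet> w) < e" by blast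
  qed
  then show "w \<in> {w. convergent (\<lambda>n. F n \<bullet> w)}" using Cauchy_convergent by blast
qed

lemma subspace_convergent_inner: "subspace {w. convergent (\<lambda>n. F n \<bullet> w)}"
  by (rule subspaceI) (auto simp: inner_add_right convergent_add convergent_mult convergent_const)

text \<open>The weak limit represents the limit functional on the closed subspace of those \<open>w\<close> for which the
  inner products converge; projecting onto that subspace takes care of all other \<open>w\<close>.\<close>

lemma weakly_convergent_if_inner_convergent:
  fixes F :: "nat \<Rightarrow> 'a::{real_inner, complete_space}"
  assumes H: "subspace H" "closed H" "\<And>n. F n \<in> H" and bound: "\<And>n. norm (F n) \<le> K"
    and conv: "\<And>k. convergent (\<lambda>n. F n \<bullet> F k)"
  obtains y where "y \<in> H" "\<And>w. (\<lambda>n. F n \<bullet> w) \<longlonglongrightarrow> y \<bullet> w"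
proof -
  define S where "S = H \<inter> {w. convergent (\<lambda>n. F n \<bullet> w)}"
  have F_in_S: "F n \<in> S" for n using conv H(3) by (simp add: S_def)
  have S: "subspace S" "closed S"
    unfolding S_def using closed_convergent_inner[OF bound]
    by (intro subspace_inter closed_Int H subspace_convergent_inner; assumption)+
  define l where "l w = lim (\<lambda>n. F n \<bullet> w)" for w
  have lim_l: "(\<lambda>n. F n \<bullet> w) \<longlonglongrightarrow> l w" if "w \<in> S" for w
    using that by (simp add: S_def l_def convergent_LIMSEQ_iff)
  have "bounded_functional_on_subspace S l K"
  proof
    show "l (w + w') = l w + l w'" if "w \<in> S" "w' \<in> S" for w w'
      using tendsto_add[OF lim_l lim_l, OF that] unfolding inner_add_right[symmetric]
      by (rule LIMSEQ_unique[OF lim_l, rotated]) (intro subspace_add S that)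
    show "l (c *\<^sub>R w) = c * l w" if "w \<in> S" for c w
      using tendsto_mult[OF tendsto_const lim_l, OF that] unfolding inner_scaleR_right[symmetric]
      by (rule LIMSEQ_unique[OF lim_l, rotated]) (intro subspace_scale S that)
    show "l w \<le> K * norm w" if "w \<in> S" for w
    proof (rule LIMSEQ_le_const2[OF lim_l[OF that]])
      have "F n \<bullet> w \<le> K * norm w" for n
        using norm_cauchy_schwarz mult_right_mono[OF bound norm_ge_zero] by (rule order.trans)
      then show "\<exists>N. \<forall>n\<ge>N. F n \<bullet> w \<le> K * norm w" by blast
    qed
  qed (rule S)
  then obtain y where y: "y \<in> S" "\<And>w. w \<in> S \<Longrightarrow> y \<bullet> w = l w"
    using Riesz_representation_on_closed_subspace S(2) by blast
  have "(\<lambda>n. F n \<bullet> w) \<longlonglongrightarrow> y \<bullet> w" for w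
  proof -
    obtain w' where w': "w' \<in> S" "\<And>v. v \<in> S \<Longrightarrow> w' \<bullet> v = w \<bullet> v"
      using orthogonal_projection_exists[OF S] by blast
    have "F n \<bullet> w = F n \<bullet> w'" "y \<bullet> w = y \<bullet> w'" for n
      using w'(2)[OF F_in_S] w'(2)[OF y(1)] by (simp_all add: inner_commute)
    then show ?thesis using lim_l[OF w'(1)] y(2)[OF w'(1)] by simp
  qed
  then show thesis using y(1) by (intro that) (auto simp: S_def)
qed

theorem bounded_sequence_has_weakly_convergent_subsequence:
  fixes F :: "nat \<Rightarrow> 'a::{real_inner, complete_space}"
  assumes H: "subspace H" "closed H" "\<And>n. F n \<in> H" and bound: "\<And>n. norm (F n) \<le> K"
  obtains r y where "strict_mono (r :: nat \<Rightarrow> nat)" "y \<in> H" "\<And>w. (\<lambda>n. F (r n) \<bullet> w) \<longlonglongrightarrow> y \<bullet> w"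
proof -
  have "norm (F n \<bullet> F k) \<le> K * K" for n k
  proof -
    have "\<bar>F n \<bullet> F k\<bar> \<le> norm (F n) * norm (F k)" by (rule Cauchy_Schwarz_ineq2)
    also have "\<dots> \<le> K * K" by (intro mult_mono bound norm_ge_zero order.trans[OF norm_ge_zero bound])
    finally show ?thesis by simp
  qed
  then obtain r where r: "strict_mono (r :: nat \<Rightarrow> nat)"
      and "\<And>k. \<exists>a. (\<lambda>n. F (r n) \<bullet> F k) \<longlonglongrightarrow> a"
    using function_convergent_subsequence[of "UNIV :: nat set" "\<lambda>n k. F n \<bullet> F k" "K * K"]
    by (metis UNIV_I countableI_type)
  then have "convergent (\<lambda>n. F (r n) \<bullet> F (r k))" for k by (simp add: convergent_def)
  then obtain y where "y \<in> H" "\<And>w. (\<lambda>n. F (r n) \<bullet> w) \<longlonglongrightarrow> y \<bullet> w"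
    using weakly_convergent_if_inner_convergent[of H "\<lambda>n. F (r n)" K, OF H bound] by blast
  with r show thesis by (rule that)
qed

section \<open>The Hilbert space of square-integrable functions\<close>

definition square_integrable ::
  "'a measure \<Rightarrow> ('a \<Rightarrow> 'b::{real_inner, second_countable_topology}) \<Rightarrow> bool" where
  "square_integrable M F \<longleftrightarrow> F \<in> borel_measurable M \<and> integrable M (\<lambda>x. (norm (F x))\<^sup>2)"

lemma square_integrable_iff_nn_integral:
  "square_integrable M F \<longleftrightarrow> F \<in> borel_measurable M \<and> (\<integral>\<^sup>+x. ennreal ((norm (F x))\<^sup>2) \<partial>M) < \<infinity>"
  by (auto simp: square_integrable_def integrable_iff_bounded)

lemma borel_measurable_square_integrable: "square_integrable M F \<Longrightarrow> F \<in> borel_measurable M"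
  by (simp add: square_integrable_def)

lemma integrable_inner_square_integrable:
  assumes "square_integrable M F" "square_integrable M G"
  shows "integrable M (\<lambda>x. F x \<bullet> G x)"
proof (rule Bochner_Integration.integrable_bound)
  have [measurable]: "F \<in> borel_measurable M" "G \<in> borel_measurable M"
    using assms by (auto simp: square_integrable_def)
  show "integrable M (\<lambda>x. (norm (F x))\<^sup>2 + (norm (G x))\<^sup>2)"
    using assms by (auto simp: square_integrable_def)
  show "(\<lambda>x. F x \<bullet> G x) \<in> borel_measurable M" by simp
  show "AE x in M. norm (F x \<bullet> G x) \<le> norm ((norm (F x))\<^sup>2 + (norm (G x))\<^sup>2)"
  proof (rule AE_I2)
    fix x
    have "\<bar>F x \<bullet> G x\<bar> \<le> norm (F x) * norm (G x)" by (rule Cauchy_Schwarz_ineq2)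
    also have "\<dots> \<le> (norm (F x))\<^sup>2 + (norm (G x))\<^sup>2"
      using sum_squares_bound[of "norm (F x)" "norm (G x)"]
        mult_nonneg_nonneg[OF norm_ge_zero[of "F x"] norm_ge_zero[of "G x"]] by linarith
    finally show "norm (F x \<bullet> G x) \<le> norm ((norm (F x))\<^sup>2 + (norm (G x))\<^sup>2)" by simp
  qed
qed

lemma square_integrable_add:
  assumes "square_integrable M F" "square_integrable M G"
  shows "square_integrable M (\<lambda>x. F x + G x)"
proof -
  have "(norm (F x + G x))\<^sup>2 = (norm (F x))\<^sup>2 + (norm (G x))\<^sup>2 + 2 * (F x \<bullet> G x)" for x
    by (simp add: power2_norm_eq_inner inner_simps inner_commute)
  then show ?thesis
    using assms integrable_inner_square_integrable[OF assms] by (auto simp: square_integrable_def)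
qed

lemma square_integrable_scaleR:
  "square_integrable M F \<Longrightarrow> square_integrable M (\<lambda>x. c *\<^sub>R F x)"
  by (auto simp: square_integrable_def power_mult_distrib)

lemma square_integrable_uminus: "square_integrable M F \<Longrightarrow> square_integrable M (\<lambda>x. - F x)"
  using square_integrable_scaleR[of M F "-1"] by simp

lemma square_integrable_diff:
  "square_integrable M F \<Longrightarrow> square_integrable M G \<Longrightarrow> square_integrable M (\<lambda>x. F x - G x)"
  using square_integrable_add[OF _ square_integrable_uminus] by fastforce

lemma square_integrable_zero: "square_integrable M (\<lambda>_. 0)"
  by (simp add: square_integrable_def)

text \<open>Only Lebesgue measure is provided for, since a type cannot depend on the measure.\<close>

quotient_type (overloaded) ('a, 'b) L2 =
  "'a::euclidean_space \<Rightarrow> 'b::{real_inner, second_countable_topology}" / partial: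
  "\<lambda>F G. square_integrable lborel F \<and> square_integrable lborel G \<and> (AE x in lborel. F x = G x)"
  morphisms rep_L2 L2_of
proof (rule part_equivpI)
  show "\<exists>F :: 'a \<Rightarrow> 'b. square_integrable lborel F \<and> square_integrable lborel F
      \<and> (AE x in lborel. F x = F x)"
    by (rule exI[of _ "\<lambda>_. 0"]) (simp add: square_integrable_zero)
qed (auto intro!: sympI transpI elim: eventually_mono AE_mp)

instantiation L2 :: (euclidean_space, "{real_inner, second_countable_topology}") real_vector
begin

lift_definition zero_L2 :: "('a, 'b) L2" is "\<lambda>_. 0"
  by (simp add: square_integrable_zero)

lift_definition plus_L2 :: "('a, 'b) L2 \<Rightarrow> ('a, 'b) L2 \<Rightarrow> ('a, 'b) L2" is "\<lambda>F G x. F x + G x"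
  by (auto intro: square_integrable_add)

lift_definition minus_L2 :: "('a, 'b) L2 \<Rightarrow> ('a, 'b) L2 \<Rightarrow> ('a, 'b) L2" is "\<lambda>F G x. F x - G x"
  by (auto intro: square_integrable_diff)

lift_definition uminus_L2 :: "('a, 'b) L2 \<Rightarrow> ('a, 'b) L2" is "\<lambda>F x. - F x"
  by (auto intro: square_integrable_uminus)

lift_definition scaleR_L2 :: "real \<Rightarrow> ('a, 'b) L2 \<Rightarrow> ('a, 'b) L2" is "\<lambda>c F x. c *\<^sub>R F x"
  by (auto intro: square_integrable_scaleR)

instance
proof
  fix F G H :: "('a, 'b) L2" and a b :: real
  note [intro] = square_integrable_add square_integrable_diff square_integrable_uminus
    square_integrable_scaleR square_integrable_zero
  show "F + G + H = F + (G + H)" "F + G = G + F" "0 + F = F" "- F + F = 0" "F - G = F + - G"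
    by (transfer; auto simp: ac_simps)+
  show "a *\<^sub>R (F + G) = a *\<^sub>R F + a *\<^sub>R G" "(a + b) *\<^sub>R F = a *\<^sub>R F + b *\<^sub>R F"
      "a *\<^sub>R b *\<^sub>R F = (a * b) *\<^sub>R F" "1 *\<^sub>R F = F"
    by (transfer; auto simp: scaleR_add_right scaleR_add_left)+
qed

end

instantiation L2 :: (euclidean_space, "{real_inner, second_countable_topology}") real_inner
begin

lift_definition inner_L2 :: "('a, 'b) L2 \<Rightarrow> ('a, 'b) L2 \<Rightarrow> real" is "\<lambda>F G. \<integral>x. F x \<bullet> G x \<partial>lborel"
  by (intro integral_cong_AE) (auto simp: square_integrable_def)

definition norm_L2 :: "('a, 'b) L2 \<Rightarrow> real" where
  "norm_L2 F = sqrt (F \<bullet> F)"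

definition dist_L2 :: "('a, 'b) L2 \<Rightarrow> ('a, 'b) L2 \<Rightarrow> real" where
  "dist_L2 F G = norm (F - G)"

definition sgn_L2 :: "('a, 'b) L2 \<Rightarrow> ('a, 'b) L2" where
  "sgn_L2 F = F /\<^sub>R norm F"

definition uniformity_L2 :: "(('a, 'b) L2 \<times> ('a, 'b) L2) filter" where
  "uniformity_L2 = (INF e\<in>{0<..}. principal {(F, G). dist F G < e})"

definition open_L2 :: "('a, 'b) L2 set \<Rightarrow> bool" where
  "open_L2 U \<longleftrightarrow> (\<forall>F\<in>U. \<forall>\<^sub>F (F', G) in uniformity. F' = F \<longrightarrow> G \<in> U)"

instance
proof
  fix F G H :: "('a, 'b) L2" and a :: real
  show "F \<bullet> G = G \<bullet> F" by transfer (simp add: inner_commute)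
  show "(F + G) \<bullet> H = F \<bullet> H + G \<bullet> H"
    by transfer (simp add: inner_add_left integrable_inner_square_integrable)
  show "(a *\<^sub>R F) \<bullet> G = a * (F \<bullet> G)" by transfer simp
  show "0 \<le> F \<bullet> F" by transfer simp
  show "F \<bullet> F = 0 \<longleftrightarrow> F = 0"
    by transfer (auto simp: integral_nonneg_eq_0_iff_AE integrable_inner_square_integrable
        square_integrable_zero)
qed (simp_all add: norm_L2_def dist_L2_def sgn_L2_def uniformity_L2_def open_L2_def)

end

lemma L2_cases:
  fixes Y :: "('a::euclidean_space, 'b::{real_inner, second_countable_topology}) L2"
  obtains F where "square_integrable lborel F" "Y = L2_of F"
  using L2.abs_induct[of "\<lambda>Y. \<exists>F. square_integrable lborel F \<and> Y = L2_of F" Y] by auto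

lemma L2_of_add:
  "square_integrable lborel F \<Longrightarrow> square_integrable lborel G \<Longrightarrow> L2_of F + L2_of G = L2_of (\<lambda>x. F x + G x)"
  by (simp add: plus_L2.abs_eq)

lemma L2_of_diff:
  "square_integrable lborel F \<Longrightarrow> square_integrable lborel G \<Longrightarrow> L2_of F - L2_of G = L2_of (\<lambda>x. F x - G x)"
  by (simp add: minus_L2.abs_eq)

lemma L2_of_scaleR:
  "square_integrable lborel F \<Longrightarrow> c *\<^sub>R L2_of F = L2_of (\<lambda>x. c *\<^sub>R F x)"
  by (simp add: scaleR_L2.abs_eq)

lemma inner_L2_of:
  "square_integrable lborel F \<Longrightarrow> square_integrable lborel G \<Longrightarrow> L2_of F \<bullet> L2_of G = (\<integral>x. F x \<bullet> G x \<partial>lborel)"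
  by (simp add: inner_L2.abs_eq)

lemma nn_integral_norm_sq_eq_norm_L2_of:
  assumes "square_integrable lborel F"
  shows "(\<integral>\<^sup>+x. ennreal ((norm (F x))\<^sup>2) \<partial>lborel) = ennreal ((norm (L2_of F))\<^sup>2)"
  using assms nn_integral_eq_integral[of lborel "\<lambda>x. (norm (F x))\<^sup>2"]
  by (simp add: power2_norm_eq_inner inner_L2_of square_integrable_def)

lemma nn_integral_norm_diff_sq_eq_dist_L2_of:
  assumes "square_integrable lborel F" "square_integrable lborel G"
  shows "(\<integral>\<^sup>+x. ennreal ((norm (F x - G x))\<^sup>2) \<partial>lborel) = ennreal ((dist (L2_of F) (L2_of G))\<^sup>2)"
  using nn_integral_norm_sq_eq_norm_L2_of[OF square_integrable_diff[OF assms]]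
  by (simp add: dist_norm L2_of_diff[OF assms])

lemma tendsto_L2_of_iff:
  assumes F: "\<And>n. square_integrable lborel (F n)" and G: "square_integrable lborel G"
  shows "((\<lambda>n. L2_of (F n)) \<longlonglongrightarrow> L2_of G)
    \<longleftrightarrow> (\<lambda>n. \<integral>\<^sup>+x. ennreal ((norm (G x - F n x))\<^sup>2) \<partial>lborel) \<longlonglongrightarrow> 0"
proof -
  have "((\<lambda>n. L2_of (F n)) \<longlonglongrightarrow> L2_of G) \<longleftrightarrow> (\<lambda>n. (dist (L2_of G) (L2_of (F n)))\<^sup>2) \<longlonglongrightarrow> 0"
    by (subst tendsto_dist_iff) (simp add: dist_commute)
  also have "\<dots> \<longleftrightarrow> (\<lambda>n. ennreal ((dist (L2_of G) (L2_of (F n)))\<^sup>2)) \<longlonglongrightarrow> ennreal 0"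
    by (rule tendsto_ennreal_iff[symmetric]) auto
  finally show ?thesis by (simp add: nn_integral_norm_diff_sq_eq_dist_L2_of[OF G F])
qed

lemma square_integrable_limit:
  assumes F: "\<And>n. square_integrable M (F n)" and G: "G \<in> borel_measurable M"
    and lim: "(\<lambda>n. \<integral>\<^sup>+x. ennreal ((norm (G x - F n x))\<^sup>2) \<partial>M) \<longlonglongrightarrow> 0"
  shows "square_integrable M G"
proof -
  have [measurable]: "F n \<in> borel_measurable M" for n
    using F by (rule borel_measurable_square_integrable)
  note [measurable] = G
  obtain n where "(\<integral>\<^sup>+x. ennreal ((norm (G x - F n x))\<^sup>2) \<partial>M) < \<infinity>"
    using eventually_happens'[OF sequentially_bot order_tendstoD(2)[OF lim, of \<infinity>]] by auto
  then have "square_integrable M (\<lambda>x. G x - F n x)"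
    by (simp add: square_integrable_iff_nn_integral)
  from square_integrable_add[OF this F[of n]] show ?thesis by simp
qed

lemma tendsto_L2_of_AE_subseq:
  assumes F: "\<And>n. square_integrable lborel (F n)" and G: "square_integrable lborel G"
    and lim: "(\<lambda>n. L2_of (F n)) \<longlonglongrightarrow> L2_of G"
  obtains r where "strict_mono (r :: nat \<Rightarrow> nat)" "AE x in lborel. (\<lambda>n. F (r n) x) \<longlonglongrightarrow> G x"
proof -
  have diff: "square_integrable lborel (\<lambda>x. F n x - G x)" for n by (rule square_integrable_diff[OF F G])
  have "(\<lambda>n. (norm (L2_of (F n) - L2_of G))\<^sup>2) \<longlonglongrightarrow> 0\<^sup>2"
    using lim by (intro tendsto_power tendsto_norm_zero LIM_zero)
  then have "(\<lambda>n. \<integral>x. norm ((norm (F n x - G x))\<^sup>2) \<partial>lborel) \<longlonglongrightarrow> 0"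
    by (simp add: L2_of_diff[OF F G] power2_norm_eq_inner inner_L2_of[OF diff diff])
  moreover have "integrable lborel (\<lambda>x. (norm (F n x - G x))\<^sup>2)" for n
    using diff by (simp add: square_integrable_def)
  ultimately obtain r :: "nat \<Rightarrow> nat" where r: "strict_mono r"
      and sq_lim: "AE x in lborel. (\<lambda>n. (norm (F (r n) x - G x))\<^sup>2) \<longlonglongrightarrow> 0"
    using tendsto_L1_AE_subseq[of lborel "\<lambda>n x. (norm (F n x - G x))\<^sup>2"] by blast
  from sq_lim have "AE x in lborel. (\<lambda>n. F (r n) x) \<longlonglongrightarrow> G x"
  proof eventually_elim
    case (elim x)
    then have "(\<lambda>n. norm (F (r n) x - G x)) \<longlonglongrightarrow> 0" by simp
    then show ?case by (simp add: LIM_zero_iff tendsto_norm_zero_iff)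
  qed
  with r show thesis by (rule that)
qed

lemma nn_integral_le_of_AE_tendsto:
  fixes f :: "nat \<Rightarrow> 'a \<Rightarrow> real" and c :: "nat \<Rightarrow> ennreal"
  assumes [measurable]: "\<And>k. f k \<in> borel_measurable M"
    and lim: "AE x in M. (\<lambda>k. f k x) \<longlonglongrightarrow> g x"
    and le: "\<And>k. (\<integral>\<^sup>+x. ennreal (f k x) \<partial>M) \<le> c k" and c: "c \<longlonglongrightarrow> b"
  shows "(\<integral>\<^sup>+x. ennreal (g x) \<partial>M) \<le> b"
proof -
  have "(\<integral>\<^sup>+x. ennreal (g x) \<partial>M) = (\<integral>\<^sup>+x. liminf (\<lambda>k. ennreal (f k x)) \<partial>M)"
    using lim by (intro nn_integral_cong_AE)
      (auto elim!: eventually_mono dest!: tendsto_ennrealI lim_imp_Liminf[OF sequentially_bot])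
  also have "\<dots> \<le> liminf (\<lambda>k. \<integral>\<^sup>+x. ennreal (f k x) \<partial>M)"
    by (rule nn_integral_liminf) simp
  also have "\<dots> \<le> liminf c"
    by (intro Liminf_mono always_eventually allI le)
  also have "\<dots> = b" by (rule lim_imp_Liminf[OF sequentially_bot c])
  finally show ?thesis .
qed

lemma summable_if_weighted_squares_bounded:
  fixes d :: "nat \<Rightarrow> 'a::banach"
  assumes "\<And>k. 2 ^ k * (norm (d k))\<^sup>2 \<le> B"
  shows "summable d"
proof (rule summable_norm_cancel, rule summable_comparison_test')
  let ?q = "1 / sqrt 2 :: real"
  have "summable (\<lambda>k. ?q ^ k)" by (rule summable_geometric) simp
  then show "summable (\<lambda>k. sqrt B * ?q ^ k)" by (rule summable_mult)
  fix k :: nat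
  have "(norm (d k))\<^sup>2 \<le> B / 2 ^ k" using assms[of k] by (simp add: field_simps)
  then have "norm (d k) \<le> sqrt (B / 2 ^ k)" by (simp add: real_le_rsqrt)
  also have "\<dots> = sqrt B * ?q ^ k" by (simp add: real_sqrt_divide real_sqrt_power power_divide)
  finally show "norm (norm (d k)) \<le> sqrt B * ?q ^ k" by simp
qed

lemma AE_convergent_if_rapidly_Cauchy_L2:
  fixes F :: "nat \<Rightarrow> 'a \<Rightarrow> 'b::{banach, second_countable_topology}"
  assumes [measurable]: "\<And>k. F k \<in> borel_measurable M"
    and rapid: "\<And>k. (\<integral>\<^sup>+x. ennreal ((norm (F (Suc k) x - F k x))\<^sup>2) \<partial>M) \<le> ennreal ((1/4) ^ k)"
  shows "AE x in M. convergent (\<lambda>k. F k x)"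
proof -
  define S where "S x = (\<Sum>k. ennreal (2 ^ k * (norm (F (Suc k) x - F k x))\<^sup>2))" for x
  have "(\<integral>\<^sup>+x. S x \<partial>M) = (\<Sum>k. ennreal (2 ^ k) * (\<integral>\<^sup>+x. ennreal ((norm (F (Suc k) x - F k x))\<^sup>2) \<partial>M))"
    unfolding S_def by (simp add: nn_integral_suminf nn_integral_cmult ennreal_mult)
  also have "\<dots> \<le> (\<Sum>k. ennreal (2 ^ k) * ennreal ((1/4) ^ k))"
    by (intro suminf_le summableI mult_left_mono rapid) simp
  also have "\<dots> = (\<Sum>k. ennreal ((1/2) ^ k))"
    by (simp flip: ennreal_mult power_mult_distrib)
  also have "\<dots> = ennreal (\<Sum>k. (1/2) ^ k)"
    by (rule suminf_ennreal2) (auto intro: summable_geometric)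
  finally have "(\<integral>\<^sup>+x. S x \<partial>M) \<noteq> \<infinity>" by (auto simp: top_unique)
  then have "AE x in M. S x \<noteq> \<infinity>"
    unfolding S_def by (intro nn_integral_PInf_AE) measurable
  then show ?thesis
  proof eventually_elim
    case (elim x)
    then obtain B where B: "S x = ennreal B" "B \<ge> 0" by (cases "S x") auto
    have "2 ^ k * (norm (F (Suc k) x - F k x))\<^sup>2 \<le> B" for k
    proof -
      have "ennreal (2 ^ k * (norm (F (Suc k) x - F k x))\<^sup>2) \<le> S x"
        unfolding S_def using sum_le_suminf[OF summableI, of "{k}"] by fastforce
      then show ?thesis using B by simp
    qed
    then have "summable (\<lambda>k. F (Suc k) x - F k x)" by (rule summable_if_weighted_squares_bounded)
    then have "convergent (\<lambda>n. F n x - F 0 x)"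
      by (simp add: summable_iff_convergent sum_lessThan_telescope[of "\<lambda>k. F k x"])
    from convergent_add[OF this convergent_const[of "F 0 x"]] show ?case by simp
  qed
qed

lemma Cauchy_rapid_subseq:
  fixes X :: "nat \<Rightarrow> 'a::metric_space"
  assumes "Cauchy X" and "\<And>k. 0 < e k"
  obtains r where "strict_mono (r :: nat \<Rightarrow> nat)" "\<And>k. dist (X (r (Suc k))) (X (r k)) < e k"
proof -
  have "\<forall>k. \<exists>N. \<forall>m\<ge>N. \<forall>n\<ge>N. dist (X m) (X n) < e k"
    using assms by (simp add: Cauchy_def)
  then obtain N where N: "\<And>k m n. N k \<le> m \<Longrightarrow> N k \<le> n \<Longrightarrow> dist (X m) (X n) < e k" by metis
  have "\<exists>r. \<forall>k. N k \<le> r k \<and> r k < r (Suc k)"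
  proof (rule dependent_nat_choice)
    show "\<exists>m. N 0 \<le> m" by blast
    show "\<exists>m'. N (Suc k) \<le> m' \<and> m < m'" for m k by (intro exI[of _ "max (N (Suc k)) (Suc m)"]) auto
  qed
  then obtain r where "\<And>k. N k \<le> r k" "\<And>k. r k < r (Suc k)" by blast
  then show thesis
    by (intro that[of r] N) (auto simp: strict_mono_Suc_iff intro: order.trans[OF _ less_imp_le])
qed

lemma Cauchy_L2_of_AE_convergent_subseq:
  fixes F :: "nat \<Rightarrow> 'a::euclidean_space \<Rightarrow> 'b::{real_inner, banach, second_countable_topology}"
  assumes F: "\<And>n. square_integrable lborel (F n)" and Cauchy: "Cauchy (\<lambda>n. L2_of (F n))"
  obtains r G where "strict_mono (r :: nat \<Rightarrow> nat)" "G \<in> borel_measurable lborel"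
    "AE x in lborel. (\<lambda>k. F (r k) x) \<longlonglongrightarrow> G x"
proof -
  have [measurable]: "F n \<in> borel_measurable borel" for n
    using borel_measurable_square_integrable[OF F] by simp
  obtain r where r: "strict_mono r"
      and rapid: "\<And>k. dist (L2_of (F (r (Suc k)))) (L2_of (F (r k))) < (1/2) ^ k"
    using Cauchy_rapid_subseq[OF Cauchy, of "\<lambda>k. (1/2) ^ k"] by auto
  have "AE x in lborel. convergent (\<lambda>k. F (r k) x)"
  proof (rule AE_convergent_if_rapidly_Cauchy_L2)
    fix k
    have "(dist (L2_of (F (r (Suc k)))) (L2_of (F (r k))))\<^sup>2 \<le> ((1/2) ^ k)\<^sup>2"
      by (rule power_mono[OF less_imp_le[OF rapid]]) simp
    also have "\<dots> = (1/4) ^ k" by (simp add: power2_eq_square flip: power_mult_distrib)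
    finally show "(\<integral>\<^sup>+x. ennreal ((norm (F (r (Suc k)) x - F (r k) x))\<^sup>2) \<partial>lborel) \<le> ennreal ((1/4) ^ k)"
      by (simp add: nn_integral_norm_diff_sq_eq_dist_L2_of[OF F F] ennreal_leI)
  qed measurable
  then have "AE x in lborel. (\<lambda>k. F (r k) x) \<longlonglongrightarrow> lim (\<lambda>k. F (r k) x)"
    by (simp add: convergent_LIMSEQ_iff)
  moreover have "(\<lambda>x. lim (\<lambda>k. F (r k) x)) \<in> borel_measurable lborel" by measurable
  ultimately show thesis using r by (intro that)
qed

lemma Cauchy_L2_of_limit:
  fixes F :: "nat \<Rightarrow> 'a::euclidean_space \<Rightarrow> 'b::{real_inner, banach, second_countable_topology}"
  assumes F: "\<And>n. square_integrable lborel (F n)" and Cauchy: "Cauchy (\<lambda>n. L2_of (F n))"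
  obtains G where "G \<in> borel_measurable lborel"
    "(\<lambda>n. \<integral>\<^sup>+x. ennreal ((norm (G x - F n x))\<^sup>2) \<partial>lborel) \<longlonglongrightarrow> 0"
proof -
  have [measurable]: "F n \<in> borel_measurable borel" for n
    using borel_measurable_square_integrable[OF F] by simp
  obtain r G where r: "strict_mono r" and G: "G \<in> borel_measurable lborel"
      and lim: "AE x in lborel. (\<lambda>k. F (r k) x) \<longlonglongrightarrow> G x"
    using Cauchy_L2_of_AE_convergent_subseq[OF F Cauchy] by blast
  have "(\<lambda>n. \<integral>\<^sup>+x. ennreal ((norm (G x - F n x))\<^sup>2) \<partial>lborel) \<longlonglongrightarrow> 0"
  proof (rule tendsto_zero_ennreal)
    fix e :: real assume "e > 0"
    then have "sqrt (e / 2) > 0" by simp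
    then obtain N where N: "\<And>m n. N \<le> m \<Longrightarrow> N \<le> n \<Longrightarrow> dist (L2_of (F m)) (L2_of (F n)) < sqrt (e / 2)"
      using Cauchy unfolding Cauchy_def by blast
    have "(\<integral>\<^sup>+x. ennreal ((norm (G x - F n x))\<^sup>2) \<partial>lborel) \<le> ennreal (e / 2)" if "N \<le> n" for n
    proof (rule nn_integral_le_of_AE_tendsto)
      show "AE x in lborel. (\<lambda>k. (norm (F (r (k + N)) x - F n x))\<^sup>2) \<longlonglongrightarrow> (norm (G x - F n x))\<^sup>2"
        using lim by eventually_elim (intro tendsto_intros LIMSEQ_ignore_initial_segment)
      show "(\<integral>\<^sup>+x. ennreal ((norm (F (r (k + N)) x - F n x))\<^sup>2) \<partial>lborel) \<le> ennreal (e / 2)" for k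
      proof -
        have "N \<le> r (k + N)" using seq_suble[OF r, of "k + N"] by simp
        from power_mono[OF less_imp_le[OF N[OF this \<open>N \<le> n\<close>]], of 2] show ?thesis
          using \<open>e > 0\<close> by (simp add: nn_integral_norm_diff_sq_eq_dist_L2_of[OF F F] ennreal_leI)
      qed
    qed auto
    moreover have "ennreal (e / 2) < ennreal e" using \<open>e > 0\<close> by (simp add: ennreal_lessI)
    ultimately show "\<forall>\<^sub>F n in sequentially. (\<integral>\<^sup>+x. ennreal ((norm (G x - F n x))\<^sup>2) \<partial>lborel) < ennreal e"
      unfolding eventually_sequentially by (meson le_less_trans)
  qed
  with G show thesis by (rule that)
qed

instance L2 :: (euclidean_space, "{real_inner, banach, second_countable_topology}") complete_space
proof
  fix X :: "nat \<Rightarrow> ('a, 'b) L2" assume X: "Cauchy X"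
  have "\<forall>n. \<exists>F. square_integrable lborel F \<and> X n = L2_of F" using L2_cases by blast
  then obtain F where F: "\<And>n. square_integrable lborel (F n)" and XF: "\<And>n. X n = L2_of (F n)" by metis
  have "Cauchy (\<lambda>n. L2_of (F n))" using X by (simp flip: XF)
  then obtain G where G: "G \<in> borel_measurable lborel"
      "(\<lambda>n. \<integral>\<^sup>+x. ennreal ((norm (G x - F n x))\<^sup>2) \<partial>lborel) \<longlonglongrightarrow> 0"
    by (rule Cauchy_L2_of_limit[OF F])
  then have "(\<lambda>n. L2_of (F n)) \<longlonglongrightarrow> L2_of G"
    using tendsto_L2_of_iff[of F G, OF F square_integrable_limit[of lborel F G, OF F G]] by blast
  then have "X \<longlonglongrightarrow> L2_of G" by (simp flip: XF)
  then show "convergent X" by (auto simp: convergent_def)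
qed

section \<open>Test functions and the weighted Sobolev space\<close>

lemma Ck_lincomb: "f \<in> Ck k \<Longrightarrow> g \<in> Ck k \<Longrightarrow> (\<lambda>x. a * f x + b * g x) \<in> Ck k"
proof (induct k arbitrary: f g)
  case 0
  then show ?case by (auto intro!: continuous_intros)
next
  case (Suc k)
  obtain Df where Df: "\<And>x. (f has_derivative (\<lambda>h. Df x \<bullet> h)) (at x)" "\<And>i. (\<lambda>x. Df x $ i) \<in> Ck k"
    using Suc.prems by auto
  obtain Dg where Dg: "\<And>x. (g has_derivative (\<lambda>h. Dg x \<bullet> h)) (at x)" "\<And>i. (\<lambda>x. Dg x $ i) \<in> Ck k"
    using Suc.prems by auto
  have "((\<lambda>x. a * f x + b * g x) has_derivative (\<lambda>h. (a *\<^sub>R Df x + b *\<^sub>R Dg x) \<bullet> h)) (at x)" for x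
    using Df(1)[of x] Dg(1)[of x] by (auto intro!: derivative_eq_intros simp: inner_simps)
  moreover have "(\<lambda>x. (a *\<^sub>R Df x + b *\<^sub>R Dg x) $ i) \<in> Ck k" for i
    using Suc.hyps[OF Df(2)[of i] Dg(2)[of i]] by simp
  ultimately show ?case using Suc.prems
    by (auto intro!: continuous_intros exI[of _ "\<lambda>x. a *\<^sub>R Df x + b *\<^sub>R Dg x"])
qed

lemma zero_in_Ck: "(\<lambda>_. 0) \<in> Ck k"
proof (induct k)
  case (Suc k)
  moreover have "inner (0 :: pt) = (\<lambda>_. 0)" by (simp add: fun_eq_iff)
  ultimately show ?case by (auto intro!: exI[of _ "\<lambda>_. 0"])
qed simp

lemma zero_in_test_fun: "(\<lambda>_. 0) \<in> test_fun"
  by (simp add: test_fun_def smooth_def zero_in_Ck)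

lemma test_fun_lincomb:
  assumes "\<phi> \<in> test_fun" "\<psi> \<in> test_fun"
  shows "(\<lambda>x. a * \<phi> x + b * \<psi> x) \<in> test_fun"
proof -
  have "closure {x. a * \<phi> x + b * \<psi> x \<noteq> 0} \<subseteq> closure ({x. \<phi> x \<noteq> 0} \<union> {x. \<psi> x \<noteq> 0})"
    by (rule closure_mono) auto
  then have "closure {x. a * \<phi> x + b * \<psi> x \<noteq> 0} \<subseteq> closure {x. \<phi> x \<noteq> 0} \<union> closure {x. \<psi> x \<noteq> 0}"
    by simp
  moreover have "compact (closure {x. \<phi> x \<noteq> 0} \<union> closure {x. \<psi> x \<noteq> 0})"
    using assms by (intro compact_Un) (auto simp: test_fun_def)
  ultimately have "compact (closure {x. a * \<phi> x + b * \<psi> x \<noteq> 0})"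
    using bounded_subset compact_eq_bounded_closed closed_closure by blast
  moreover have "(\<lambda>x. a * \<phi> x + b * \<psi> x) \<in> Ck k" for k
    using assms by (intro Ck_lincomb) (simp_all add: test_fun_def smooth_def)
  ultimately show ?thesis by (simp add: test_fun_def smooth_def)
qed

lemma grad_eqI:
  assumes "(f has_derivative (\<lambda>h. D \<bullet> h)) (at x)"
  shows "grad f x = D"
  using frechet_derivative_at[OF assms, symmetric] by (simp add: grad_def vec_eq_iff inner_axis)

lemma test_fun_has_derivative:
  assumes "\<phi> \<in> test_fun"
  shows "(\<phi> has_derivative (\<lambda>h. grad \<phi> x \<bullet> h)) (at x)"
proof -
  have "\<phi> \<in> Ck (Suc 0)" using assms by (auto simp only: test_fun_def smooth_def)
  then obtain D where "\<And>x. (\<phi> has_derivative (\<lambda>h. D x \<bullet> h)) (at x)" by auto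
  then show ?thesis using grad_eqI by metis
qed

lemma grad_lincomb:
  assumes "\<phi> \<in> test_fun" "\<psi> \<in> test_fun"
  shows "grad (\<lambda>x. a * \<phi> x + b * \<psi> x) x = a *\<^sub>R grad \<phi> x + b *\<^sub>R grad \<psi> x"
  using test_fun_has_derivative[OF assms(1), of x] test_fun_has_derivative[OF assms(2), of x]
  by (intro grad_eqI) (auto intro!: derivative_eq_intros simp: inner_simps)

lemma test_fun_continuous_grad:
  assumes "\<phi> \<in> test_fun"
  shows "continuous_on UNIV (grad \<phi>)"
proof -
  have "\<phi> \<in> Ck (Suc 0)" using assms by (auto simp only: test_fun_def smooth_def)
  then obtain D where D: "\<And>x. (\<phi> has_derivative (\<lambda>h. D x \<bullet> h)) (at x)"
      "\<And>i. continuous_on UNIV (\<lambda>x. D x $ i)" by auto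
  have "continuous_on UNIV (\<lambda>x. \<chi> i. D x $ i)" by (intro continuous_on_vec_lambda D(2))
  moreover have "grad \<phi> = D" using grad_eqI[OF D(1)] by auto
  ultimately show ?thesis by simp
qed

lemma test_fun_continuous:
  assumes "\<phi> \<in> test_fun"
  shows "continuous_on UNIV \<phi>"
  using test_fun_has_derivative[OF assms]
  by (intro continuous_at_imp_continuous_on ballI has_derivative_continuous)

lemma borel_measurable_test_fun:
  assumes "\<phi> \<in> test_fun"
  shows "\<phi> \<in> borel_measurable borel" "grad \<phi> \<in> borel_measurable borel"
  using test_fun_continuous[OF assms] test_fun_continuous_grad[OF assms]
  by (simp_all add: borel_measurable_continuous_onI)

lemma test_fun_support:
  assumes "\<phi> \<in> test_fun"
  obtains R where "\<And>x. norm x \<ge> R \<Longrightarrow> \<phi> x = 0" "\<And>x. norm x \<ge> R \<Longrightarrow> grad \<phi> x = 0"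
proof -
  let ?K = "closure {x. \<phi> x \<noteq> 0}"
  have "bounded ?K" using assms by (auto simp: test_fun_def compact_imp_bounded)
  then obtain R where R: "\<And>x. x \<in> ?K \<Longrightarrow> norm x < R" by (meson bounded_pos_less)
  have outside: "x \<notin> ?K" if "norm x \<ge> R" for x using R that by force
  have "\<phi> x = 0" if "norm x \<ge> R" for x
    using outside[OF that] closure_subset[of "{x. \<phi> x \<noteq> 0}"] by auto
  moreover have "grad \<phi> x = 0" if "norm x \<ge> R" for x
  proof (rule grad_eqI)
    have "((\<lambda>_. 0 :: real) has_derivative (\<lambda>h. 0 \<bullet> h)) (at x)" by simp
    then show "(\<phi> has_derivative (\<lambda>h. 0 \<bullet> h)) (at x)"
    proof (rule has_derivative_transform_within_open)
      show "open (- ?K)" by auto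
      show "x \<in> - ?K" using outside[OF that] by simp
      show "0 = \<phi> y" if "y \<in> - ?K" for y
        using that closure_subset[of "{x. \<phi> x \<noteq> 0}"] by auto
    qed
  qed
  ultimately show thesis using that by blast
qed

lemma integrable_continuous_bounded_support:
  fixes f :: "'a::euclidean_space \<Rightarrow> real"
  assumes "continuous_on UNIV f" and support: "\<And>x. norm x \<ge> R \<Longrightarrow> f x = 0"
  shows "integrable lborel f"
proof -
  have "integrable lborel (\<lambda>x. indicator (cball 0 R) x *\<^sub>R f x)"
    using assms(1) by (intro borel_integrable_compact) (auto intro: continuous_on_subset)
  also have "(\<lambda>x. indicator (cball 0 R) x *\<^sub>R f x) = f"
    using support by (auto simp: indicator_def fun_eq_iff)
  finally show ?thesis .
qed

type_synonym H1_pair = "(pt \<Rightarrow> real) \<times> (pt \<Rightarrow> pt)"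

text \<open>This map identifies the \<open>V\<close>-inner product with that of \<open>L\<^sup>2(\<real>\<^sup>2; \<real> \<times> \<real>\<^sup>2)\<close>.\<close>

definition weighted_pair :: "(pt \<Rightarrow> real) \<Rightarrow> H1_pair \<Rightarrow> pt \<Rightarrow> real \<times> pt" where
  "weighted_pair V v x = (sqrt (V x) * fst v x, snd v x)"

abbreviation test_pair :: "(pt \<Rightarrow> real) \<Rightarrow> H1_pair" where
  "test_pair \<phi> \<equiv> (\<phi>, grad \<phi>)"

abbreviation pair_diff :: "H1_pair \<Rightarrow> H1_pair \<Rightarrow> H1_pair" where
  "pair_diff v w \<equiv> (\<lambda>x. fst v x - fst w x, \<lambda>x. snd v x - snd w x)"

lemma closure_image_sequential:
  fixes f :: "'a \<Rightarrow> 'b::first_countable_topology"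
  shows "l \<in> closure (f ` A) \<longleftrightarrow> (\<exists>x. (\<forall>n. x n \<in> A) \<and> (\<lambda>n. f (x n)) \<longlonglongrightarrow> l)"
proof
  assume "l \<in> closure (f ` A)"
  then obtain y where y: "\<forall>n. y n \<in> f ` A" "y \<longlonglongrightarrow> l" unfolding closure_sequential by blast
  then have "\<forall>n. \<exists>x\<in>A. y n = f x" by blast
  then obtain x where "\<And>n. x n \<in> A" "\<And>n. y n = f (x n)" by metis
  moreover from this have "y = (\<lambda>n. f (x n))" by blast
  ultimately show "\<exists>x. (\<forall>n. x n \<in> A) \<and> (\<lambda>n. f (x n)) \<longlonglongrightarrow> l" using y(2) by blast
next
  assume "\<exists>x. (\<forall>n. x n \<in> A) \<and> (\<lambda>n. f (x n)) \<longlonglongrightarrow> l"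
  then obtain x where "\<forall>n. x n \<in> A" "(\<lambda>n. f (x n)) \<longlonglongrightarrow> l" by blast
  then show "l \<in> closure (f ` A)"
    unfolding closure_sequential by (intro exI[of _ "\<lambda>n. f (x n)"]) simp
qed

locale positive_potential =
  fixes V :: "pt \<Rightarrow> real"
  assumes V_continuous: "continuous_on UNIV V" and V_pos: "\<And>x. V x > 0"
begin

lemma borel_measurable_V [measurable]: "V \<in> borel_measurable borel"
  using V_continuous by (rule borel_measurable_continuous_onI)

lemma V_nonneg [simp]: "0 \<le> V x"
  using V_pos less_imp_le by blast

lemma norm_weighted_pair: "(norm (weighted_pair V v x))\<^sup>2 = (norm (snd v x))\<^sup>2 + V x * (fst v x)\<^sup>2"
  by (simp add: weighted_pair_def norm_Pair power_mult_distrib)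

lemma weighted_pair_diff: "weighted_pair V (pair_diff v w) x = weighted_pair V v x - weighted_pair V w x"
  by (simp add: weighted_pair_def right_diff_distrib)

lemma inner_weighted_pair:
  "weighted_pair V v x \<bullet> weighted_pair V w x = snd v x \<bullet> snd w x + V x * fst v x * fst w x"
proof -
  have "weighted_pair V v x \<bullet> weighted_pair V w x
      = (sqrt (V x) * sqrt (V x)) * fst v x * fst w x + snd v x \<bullet> snd w x"
    unfolding weighted_pair_def inner_prod_def fst_conv snd_conv inner_real_def by (simp only: ac_simps)
  then show ?thesis by simp
qed

lemma borel_measurable_weighted_pair:
  assumes [measurable]: "fst v \<in> borel_measurable lborel" "snd v \<in> borel_measurable lborel"
  shows "weighted_pair V v \<in> borel_measurable lborel"
  unfolding weighted_pair_def[abs_def] by measurable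

lemma square_integrable_test_pair:
  assumes \<phi>: "\<phi> \<in> test_fun"
  shows "square_integrable lborel (weighted_pair V (test_pair \<phi>))"
proof -
  obtain R where "\<And>x. norm x \<ge> R \<Longrightarrow> \<phi> x = 0" "\<And>x. norm x \<ge> R \<Longrightarrow> grad \<phi> x = 0"
    using test_fun_support[OF \<phi>] by blast
  then have "integrable lborel (\<lambda>x. (norm (grad \<phi> x))\<^sup>2 + V x * (\<phi> x)\<^sup>2)"
    by (intro integrable_continuous_bounded_support[of _ R] continuous_intros V_continuous
        test_fun_continuous[OF \<phi>] test_fun_continuous_grad[OF \<phi>]) auto
  then show ?thesis
    using borel_measurable_weighted_pair[of "test_pair \<phi>"] borel_measurable_test_fun[OF \<phi>]
    by (simp add: square_integrable_def norm_weighted_pair)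
qed

definition L2_pair :: "H1_pair \<Rightarrow> (pt, real \<times> pt) L2" where
  "L2_pair v = L2_of (weighted_pair V v)"

definition test_space :: "(pt, real \<times> pt) L2 set" where
  "test_space = (\<lambda>\<phi>. L2_pair (test_pair \<phi>)) ` test_fun"

lemma L2_pair_test_pair_lincomb:
  assumes \<phi>: "\<phi> \<in> test_fun" and \<psi>: "\<psi> \<in> test_fun"
  shows "a *\<^sub>R L2_pair (test_pair \<phi>) + b *\<^sub>R L2_pair (test_pair \<psi>)
    = L2_pair (test_pair (\<lambda>x. a * \<phi> x + b * \<psi> x))"
proof -
  have "weighted_pair V (test_pair (\<lambda>x. a * \<phi> x + b * \<psi> x))
      = (\<lambda>x. a *\<^sub>R weighted_pair V (test_pair \<phi>) x + b *\<^sub>R weighted_pair V (test_pair \<psi>) x)"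
    by (auto simp: weighted_pair_def fun_eq_iff grad_lincomb[OF \<phi> \<psi>] algebra_simps)
  then show ?thesis
    using square_integrable_test_pair[OF \<phi>] square_integrable_test_pair[OF \<psi>]
    by (simp add: L2_pair_def L2_of_scaleR L2_of_add square_integrable_scaleR)
qed

lemma subspace_test_space: "subspace test_space"
proof (rule subspaceI)
  have lincomb: "a *\<^sub>R F + b *\<^sub>R G \<in> test_space" if "F \<in> test_space" "G \<in> test_space" for a b F G
    using that unfolding test_space_def
    by (auto simp: L2_pair_test_pair_lincomb intro!: imageI test_fun_lincomb)
  show "F + G \<in> test_space" if "F \<in> test_space" "G \<in> test_space" for F G
    using lincomb[OF that, of 1 1] by simp
  show "c *\<^sub>R F \<in> test_space" if "F \<in> test_space" for c F
    using lincomb[OF that that, of c 0] by simp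
  have "L2_pair (test_pair (\<lambda>_. 0)) \<in> test_space"
    unfolding test_space_def by (intro imageI zero_in_test_fun)
  from lincomb[OF this this, of 0 0] show "0 \<in> test_space" by simp
qed

lemma tendsto_L2_pair_test_pair_iff:
  assumes \<phi>: "\<And>n. \<phi> n \<in> test_fun" and v: "square_integrable lborel (weighted_pair V v)"
  shows "((\<lambda>n. L2_pair (test_pair (\<phi> n))) \<longlonglongrightarrow> L2_pair v) \<longleftrightarrow>
    (\<lambda>n. \<integral>\<^sup>+x. ennreal ((norm (snd v x - grad (\<phi> n) x))\<^sup>2 + V x * (fst v x - \<phi> n x)\<^sup>2) \<partial>lborel) \<longlonglongrightarrow> 0"
  unfolding L2_pair_def tendsto_L2_of_iff[OF square_integrable_test_pair[OF \<phi>] v]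
  by (simp add: norm_weighted_pair flip: weighted_pair_diff)

lemma H1V_iff:
  "v \<in> H1V V \<longleftrightarrow> fst v \<in> borel_measurable lborel \<and> snd v \<in> borel_measurable lborel
    \<and> square_integrable lborel (weighted_pair V v) \<and> L2_pair v \<in> closure test_space"
proof -
  define conv where "conv \<phi> \<longleftrightarrow>
    (\<lambda>n. \<integral>\<^sup>+x. ennreal ((norm (snd v x - grad (\<phi> n) x))\<^sup>2 + V x * (fst v x - \<phi> n x)\<^sup>2) \<partial>lborel) \<longlonglongrightarrow> 0"
    for \<phi> :: "nat \<Rightarrow> pt \<Rightarrow> real"
  have "square_integrable lborel (weighted_pair V v)"
    if "fst v \<in> borel_measurable lborel" "snd v \<in> borel_measurable lborel"
      and "\<And>n. \<phi> n \<in> test_fun" "conv \<phi>" for \<phi>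
  proof (rule square_integrable_limit)
    show "(\<lambda>n. \<integral>\<^sup>+x. ennreal ((norm (weighted_pair V v x
        - weighted_pair V (test_pair (\<phi> n)) x))\<^sup>2) \<partial>lborel) \<longlonglongrightarrow> 0"
      using \<open>conv \<phi>\<close> by (simp add: conv_def norm_weighted_pair flip: weighted_pair_diff)
    show "weighted_pair V v \<in> borel_measurable lborel"
      using that by (intro borel_measurable_weighted_pair)
  qed (use that in \<open>simp add: square_integrable_test_pair\<close>)
  moreover have "L2_pair v \<in> closure test_space \<longleftrightarrow> (\<exists>\<phi>. (\<forall>n. \<phi> n \<in> test_fun) \<and> conv \<phi>)"
    if "square_integrable lborel (weighted_pair V v)"
    using tendsto_L2_pair_test_pair_iff[OF _ that]
    unfolding test_space_def closure_image_sequential conv_def by blast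
  ultimately show ?thesis
    unfolding H1V_def conv_def by (cases v) auto
qed

lemma square_integrable_H1V: "v \<in> H1V V \<Longrightarrow> square_integrable lborel (weighted_pair V v)"
  by (simp add: H1V_iff)

lemma borel_measurable_H1V:
  "v \<in> H1V V \<Longrightarrow> fst v \<in> borel_measurable borel" "v \<in> H1V V \<Longrightarrow> snd v \<in> borel_measurable borel"
  by (simp_all add: H1V_iff)

lemma test_pair_in_H1V:
  assumes "\<phi> \<in> test_fun"
  shows "test_pair \<phi> \<in> H1V V"
proof -
  have "L2_pair (test_pair \<phi>) \<in> closure test_space"
    unfolding test_space_def by (intro subsetD[OF closure_subset] imageI assms)
  then show ?thesis
    using square_integrable_test_pair[OF assms] borel_measurable_test_fun[OF assms]
    by (simp add: H1V_iff)
qed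

lemma closure_test_space_eq: "closure test_space = L2_pair ` H1V V"
proof
  show "L2_pair ` H1V V \<subseteq> closure test_space" using H1V_iff by blast
  show "closure test_space \<subseteq> L2_pair ` H1V V"
  proof
    fix Y assume Y: "Y \<in> closure test_space"
    obtain F where F: "square_integrable lborel F" "Y = L2_of F" by (rule L2_cases)
    define v where "v = (\<lambda>x. fst (F x) / sqrt (V x), \<lambda>x. snd (F x))"
    have "weighted_pair V v = F"
      using V_pos by (auto simp: weighted_pair_def v_def fun_eq_iff less_imp_neq[THEN not_sym])
    moreover note F_measurable = borel_measurable_square_integrable[OF F(1)]
    have [measurable]: "(\<lambda>x. fst (F x)) \<in> borel_measurable lborel"
        "(\<lambda>x. snd (F x)) \<in> borel_measurable lborel"
      by (rule measurable_compose[OF F_measurable borel_measurable_continuous_onI],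
          intro continuous_intros)+
    have "fst v \<in> borel_measurable lborel" "snd v \<in> borel_measurable lborel"
      unfolding v_def fst_conv snd_conv by measurable
    ultimately have "v \<in> H1V V" "Y = L2_pair v"
      using F Y by (simp_all add: H1V_iff L2_pair_def)
    then show "Y \<in> L2_pair ` H1V V" by blast
  qed
qed

lemma subspace_H1V: "subspace (L2_pair ` H1V V)" and closed_H1V: "closed (L2_pair ` H1V V)"
  using subspace_closure[OF subspace_test_space] by (simp_all flip: closure_test_space_eq)

lemma innerV_eq_inner: "v \<in> H1V V \<Longrightarrow> w \<in> H1V V \<Longrightarrow> innerV V v w = L2_pair v \<bullet> L2_pair w"
  by (simp add: innerV_def L2_pair_def inner_L2_of square_integrable_H1V inner_weighted_pair)

lemma normV_sq_eq_norm: "v \<in> H1V V \<Longrightarrow> normV_sq V v = (norm (L2_pair v))\<^sup>2"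
  by (simp add: normV_sq_def innerV_eq_inner power2_norm_eq_inner)

lemma normV_sq_nonneg: "v \<in> H1V V \<Longrightarrow> 0 \<le> normV_sq V v"
  by (simp add: normV_sq_eq_norm)

lemma nn_integral_weighted_pair:
  "v \<in> H1V V \<Longrightarrow> (\<integral>\<^sup>+x. ennreal ((norm (weighted_pair V v x))\<^sup>2) \<partial>lborel) = ennreal (normV_sq V v)"
  by (simp add: nn_integral_norm_sq_eq_norm_L2_of square_integrable_H1V normV_sq_eq_norm L2_pair_def)

lemma L2_pair_diff: "v \<in> H1V V \<Longrightarrow> w \<in> H1V V \<Longrightarrow> L2_pair (pair_diff v w) = L2_pair v - L2_pair w"
  unfolding L2_pair_def weighted_pair_diff[abs_def] by (simp add: L2_of_diff square_integrable_H1V)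

lemma pair_diff_in_H1V:
  assumes v: "v \<in> H1V V" and w: "w \<in> H1V V"
  shows "pair_diff v w \<in> H1V V"
proof -
  have "L2_pair (pair_diff v w) \<in> closure test_space"
    unfolding L2_pair_diff[OF v w] closure_test_space_eq
    using v w by (intro subspace_diff subspace_H1V) auto
  moreover have "square_integrable lborel (weighted_pair V (pair_diff v w))"
    unfolding weighted_pair_diff[abs_def]
    using v w by (intro square_integrable_diff square_integrable_H1V)
  moreover have "fst (pair_diff v w) \<in> borel_measurable lborel"
      "snd (pair_diff v w) \<in> borel_measurable lborel"
    using v w borel_measurable_H1V by (auto intro: borel_measurable_diff)
  ultimately show ?thesis unfolding H1V_iff by blast
qed

lemma weak_conv_V_iff:
  assumes s: "\<And>n. s n \<in> H1V V" and v: "v \<in> H1V V"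
  shows "weak_conv_V V s v \<longleftrightarrow> (\<forall>w. (\<lambda>n. L2_pair (s n) \<bullet> w) \<longlonglongrightarrow> L2_pair v \<bullet> w)"
proof
  assume weak: "weak_conv_V V s v"
  show "\<forall>w. (\<lambda>n. L2_pair (s n) \<bullet> w) \<longlonglongrightarrow> L2_pair v \<bullet> w"
  proof
    fix w
    obtain y where y: "y \<in> L2_pair ` H1V V" "\<And>x. x \<in> L2_pair ` H1V V \<Longrightarrow> y \<bullet> x = w \<bullet> x"
      using orthogonal_projection_exists[OF subspace_H1V closed_H1V] by blast
    then have "L2_pair x \<bullet> w = L2_pair x \<bullet> y" if "x \<in> H1V V" for x
      using that by (metis imageI inner_commute)
    moreover obtain w' where "w' \<in> H1V V" "y = L2_pair w'" using y(1) by blast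
    ultimately show "(\<lambda>n. L2_pair (s n) \<bullet> w) \<longlonglongrightarrow> L2_pair v \<bullet> w"
      using weak s v by (simp add: weak_conv_V_def innerV_eq_inner)
  qed
next
  assume "\<forall>w. (\<lambda>n. L2_pair (s n) \<bullet> w) \<longlonglongrightarrow> L2_pair v \<bullet> w"
  then show "weak_conv_V V s v" using s v by (simp add: weak_conv_V_def innerV_eq_inner)
qed

theorem H1V_weakly_sequentially_compact:
  assumes u: "\<And>n. u n \<in> H1V V" and bound: "\<And>n. normV_sq V (u n) \<le> K"
  obtains r u0 where "strict_mono (r :: nat \<Rightarrow> nat)" "u0 \<in> H1V V" "weak_conv_V V (u \<circ> r) u0"
proof -
  have "norm (L2_pair (u n)) \<le> sqrt K" for n
    using bound[of n] by (simp add: normV_sq_eq_norm[OF u] real_le_rsqrt)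
  then obtain r y where r: "strict_mono (r :: nat \<Rightarrow> nat)" and y: "y \<in> L2_pair ` H1V V"
      and weak: "\<And>w. (\<lambda>n. L2_pair (u (r n)) \<bullet> w) \<longlonglongrightarrow> y \<bullet> w"
    using bounded_sequence_has_weakly_convergent_subsequence[of "L2_pair ` H1V V" "\<lambda>n. L2_pair (u n)",
        OF subspace_H1V closed_H1V] u
    by blast
  then obtain u0 where "u0 \<in> H1V V" "y = L2_pair u0" by blast
  with r weak u show thesis by (intro that[of r u0]) (auto simp: weak_conv_V_iff)
qed

lemma H1V_test_sequence:
  assumes v: "v \<in> H1V V"
  obtains \<phi> where "\<And>n. \<phi> n \<in> test_fun" "(\<lambda>n. normV_sq V (test_pair (\<phi> n))) \<longlonglongrightarrow> normV_sq V v"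
    "AE x in lborel. (\<lambda>n. \<phi> n x) \<longlonglongrightarrow> fst v x"
proof -
  obtain \<psi> where \<psi>: "\<And>n. \<psi> n \<in> test_fun" and lim: "(\<lambda>n. L2_pair (test_pair (\<psi> n))) \<longlonglongrightarrow> L2_pair v"
    using v unfolding H1V_iff test_space_def closure_image_sequential by blast
  obtain r where r: "strict_mono (r :: nat \<Rightarrow> nat)"
      and lim_AE: "AE x in lborel. (\<lambda>n. weighted_pair V (test_pair (\<psi> (r n))) x) \<longlonglongrightarrow> weighted_pair V v x"
    using tendsto_L2_of_AE_subseq[of "\<lambda>n. weighted_pair V (test_pair (\<psi> n))",
        OF square_integrable_test_pair[OF \<psi>] square_integrable_H1V[OF v] lim[unfolded L2_pair_def]]
    by blast
  have "(\<lambda>n. (norm (L2_pair (test_pair (\<psi> (r n)))))\<^sup>2) \<longlonglongrightarrow> (norm (L2_pair v))\<^sup>2"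
    using LIMSEQ_subseq_LIMSEQ[OF lim r] by (intro tendsto_intros) (simp add: o_def)
  then have "(\<lambda>n. normV_sq V (test_pair (\<psi> (r n)))) \<longlonglongrightarrow> normV_sq V v"
    by (simp add: normV_sq_eq_norm v test_pair_in_H1V \<psi>)
  moreover have "AE x in lborel. (\<lambda>n. \<psi> (r n) x) \<longlonglongrightarrow> fst v x"
    using lim_AE
  proof eventually_elim
    case (elim x)
    from tendsto_divide[OF tendsto_fst[OF this] tendsto_const[of "sqrt (V x)"]] V_pos[of x]
    show ?case by (simp add: weighted_pair_def)
  qed
  ultimately show thesis using \<psi> by (intro that[of "\<lambda>n. \<psi> (r n)"]) auto
qed

lemma normV_sq_pos:
  assumes v: "v \<in> H1V V" and nonzero: "nonzeroV v"
  shows "0 < normV_sq V v"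
proof (rule ccontr)
  assume "\<not> ?thesis"
  then have "(\<integral>\<^sup>+x. ennreal ((norm (weighted_pair V v x))\<^sup>2) \<partial>lborel) = 0"
    using v by (simp add: nn_integral_weighted_pair ennreal_eq_0_iff)
  then have "AE x in lborel. weighted_pair V v x = 0"
    using borel_measurable_square_integrable[OF square_integrable_H1V[OF v]]
    by (subst (asm) nn_integral_0_iff_AE) auto
  then have "AE x in lborel. fst v x = 0"
    using V_pos
    by (auto elim!: eventually_mono simp: weighted_pair_def zero_prod_def less_imp_neq[THEN not_sym])
  then show False using nonzero by (simp add: nonzeroV_def)
qed

end

section \<open>The Gagliardo--Nirenberg inequality in the plane\<close>

definition pt_of :: "real \<Rightarrow> real \<Rightarrow> pt" where
  "pt_of s t = s *\<^sub>R axis 1 1 + t *\<^sub>R axis 2 1"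

lemma pt_of_nth [simp]: "pt_of s t $ 1 = s" "pt_of s t $ 2 = t"
  by (simp_all add: pt_of_def axis_def)

lemma borel_measurable_pt_of [measurable]:
  assumes [measurable]: "f \<in> borel_measurable M" "g \<in> borel_measurable M"
  shows "(\<lambda>x. pt_of (f x) (g x)) \<in> borel_measurable M"
  unfolding pt_of_def by measurable

lemma borel_measurable_pt_of_pair: "(\<lambda>(s, t). pt_of s t) \<in> borel_measurable (lborel \<Otimes>\<^sub>M lborel)"
  by measurable

lemma lborel_eq_distr_pt_of:
  "(lborel :: pt measure) = distr (lborel \<Otimes>\<^sub>M lborel) borel (\<lambda>(s, t). pt_of s t)"
proof (rule lborel_eqI)
  fix l u :: pt assume Basis_le: "\<And>b. b \<in> Basis \<Longrightarrow> l \<bullet> b \<le> u \<bullet> b"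
  have nth_le: "l $ i \<le> u $ i" for i
    using Basis_le[of "axis i 1"] by (auto simp: inner_axis axis_in_Basis_iff)
  have vimage_box: "(\<lambda>(s, t). pt_of s t) -` box l u \<inter> space (lborel \<Otimes>\<^sub>M lborel)
      = {l$1<..<u$1} \<times> {l$2<..<u$2}"
    by (auto simp: space_pair_measure mem_box_cart forall_2)
  have "emeasure (distr (lborel \<Otimes>\<^sub>M lborel) borel (\<lambda>(s, t). pt_of s t)) (box l u)
     = emeasure (lborel \<Otimes>\<^sub>M lborel) ({l$1<..<u$1} \<times> {l$2<..<u$2})"
    by (subst emeasure_distr[OF borel_measurable_pt_of_pair]) (auto simp: vimage_box)
  also have "\<dots> = ennreal (u$1 - l$1) * ennreal (u$2 - l$2)"
    using nth_le by (subst lborel.emeasure_pair_measure_Times) auto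
  also have "\<dots> = ennreal ((u$1 - l$1) * (u$2 - l$2))"
    using nth_le by (simp add: ennreal_mult)
  also have "(u$1 - l$1) * (u$2 - l$2) = (\<Prod>i\<in>UNIV. (u - l) $ i)"
    by (simp add: UNIV_2)
  also have "\<dots> = (\<Prod>b\<in>(\<lambda>i. axis i 1) ` UNIV. (u - l) \<bullet> b)"
    by (subst prod.reindex) (auto simp: inj_on_def axis_eq_axis inner_axis)
  also have "(\<lambda>i. axis i 1) ` UNIV = (Basis :: pt set)"
    by (auto simp: Basis_vec_def)
  finally show "emeasure (distr (lborel \<Otimes>\<^sub>M lborel) borel (\<lambda>(s, t). pt_of s t)) (box l u)
     = (\<Prod>b\<in>Basis. (u - l) \<bullet> b)" .
qed simp

lemma nn_integral_pt_of:
  assumes [measurable]: "f \<in> borel_measurable borel"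
  shows "(\<integral>\<^sup>+x. f x \<partial>lborel) = (\<integral>\<^sup>+s. \<integral>\<^sup>+t. f (pt_of s t) \<partial>lborel \<partial>lborel)"
proof -
  have "(\<integral>\<^sup>+x. f x \<partial>lborel) = (\<integral>\<^sup>+z. f (case z of (s, t) \<Rightarrow> pt_of s t) \<partial>(lborel \<Otimes>\<^sub>M lborel))"
    by (subst lborel_eq_distr_pt_of, subst nn_integral_distr[OF borel_measurable_pt_of_pair]) auto
  also have "\<dots> = (\<integral>\<^sup>+s. \<integral>\<^sup>+t. f (case (s, t) of (s, t) \<Rightarrow> pt_of s t) \<partial>lborel \<partial>lborel)"
    by (rule lborel.nn_integral_fst[symmetric]) (use borel_measurable_pt_of_pair in measurable)
  finally show ?thesis by simp
qed

lemma nn_integral_pt_of_swap: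
  assumes [measurable]: "f \<in> borel_measurable borel"
  shows "(\<integral>\<^sup>+x. f x \<partial>lborel) = (\<integral>\<^sup>+t. \<integral>\<^sup>+s. f (pt_of s t) \<partial>lborel \<partial>lborel)"
  unfolding nn_integral_pt_of[OF assms] by (rule lborel_pair.Fubini') measurable

lemma abs_diff_le_nn_integral_deriv:
  fixes f f' :: "real \<Rightarrow> real"
  assumes "a \<le> b" and der: "\<And>s. (f has_real_derivative f' s) (at s)" and cont: "continuous_on UNIV f'"
  shows "ennreal \<bar>f b - f a\<bar> \<le> (\<integral>\<^sup>+s. ennreal \<bar>f' s\<bar> * indicator {a..b} s \<partial>lborel)"
proof -
  have "has_bochner_integral lborel (\<lambda>s. f' s * indicator {a..b} s) (f b - f a)"
    using assms cont by (intro has_bochner_integral_FTC_Icc_real)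
      (auto simp: continuous_on_eq_continuous_at)
  then have "integrable lborel (\<lambda>s. f' s * indicator {a..b} s)"
    and eq: "f b - f a = (\<integral>s. f' s * indicator {a..b} s \<partial>lborel)"
    by (auto simp: has_bochner_integral_iff)
  then have "ennreal (norm (\<integral>s. f' s * indicator {a..b} s \<partial>lborel))
      \<le> (\<integral>\<^sup>+s. ennreal (norm (f' s * indicator {a..b} s)) \<partial>lborel)"
    by (intro integral_norm_bound_ennreal)
  also have "\<dots> = (\<integral>\<^sup>+s. ennreal \<bar>f' s\<bar> * indicator {a..b} s \<partial>lborel)"
    by (intro nn_integral_cong) (auto simp: indicator_def)
  finally show ?thesis using eq by simp
qed

lemma abs_diff_line_le_nn_integral:
  fixes w :: "'a::euclidean_space \<Rightarrow> real"
  assumes der: "\<And>x. (w has_derivative (\<lambda>h. Dw x \<bullet> h)) (at x)" and cont: "continuous_on UNIV Dw"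
    and "a \<le> b"
  shows "ennreal \<bar>w (x + b *\<^sub>R v) - w (x + a *\<^sub>R v)\<bar>
    \<le> (\<integral>\<^sup>+s. ennreal (norm v * norm (Dw (x + s *\<^sub>R v))) * indicator {a..b} s \<partial>lborel)"
proof -
  have "((\<lambda>s. w (x + s *\<^sub>R v)) has_real_derivative (Dw (x + s *\<^sub>R v) \<bullet> v)) (at s)" for s
  proof -
    have "((\<lambda>s. x + s *\<^sub>R v) has_derivative (\<lambda>h. h *\<^sub>R v)) (at s)"
      by (auto intro!: derivative_eq_intros)
    from has_derivative_compose[OF this der]
    have "((\<lambda>s. w (x + s *\<^sub>R v)) has_derivative (\<lambda>h. Dw (x + s *\<^sub>R v) \<bullet> (h *\<^sub>R v))) (at s)" by simp
    then show ?thesis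
      unfolding has_field_derivative_def by (rule has_derivative_eq_rhs) (simp add: fun_eq_iff)
  qed
  moreover have "continuous_on UNIV (\<lambda>s. Dw (x + s *\<^sub>R v) \<bullet> v)"
    by (intro continuous_intros continuous_on_compose2[OF cont]) auto
  ultimately have "ennreal \<bar>w (x + b *\<^sub>R v) - w (x + a *\<^sub>R v)\<bar>
      \<le> (\<integral>\<^sup>+s. ennreal \<bar>Dw (x + s *\<^sub>R v) \<bullet> v\<bar> * indicator {a..b} s \<partial>lborel)"
    using \<open>a \<le> b\<close> by (intro abs_diff_le_nn_integral_deriv)
  also have "\<dots> \<le> (\<integral>\<^sup>+s. ennreal (norm v * norm (Dw (x + s *\<^sub>R v))) * indicator {a..b} s \<partial>lborel)"
    using Cauchy_Schwarz_ineq2[of _ v]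
    by (intro nn_integral_mono mult_right_mono ennreal_leI) (simp_all add: mult.commute[of "norm v"])
  finally show ?thesis .
qed

lemma abs_le_nn_integral_line:
  fixes w :: "'a::euclidean_space \<Rightarrow> real"
  assumes der: "\<And>x. (w has_derivative (\<lambda>h. Dw x \<bullet> h)) (at x)" and cont: "continuous_on UNIV Dw"
    and "norm v = 1" "w (x + r *\<^sub>R v) = 0" "r \<le> t"
  shows "ennreal \<bar>w (x + t *\<^sub>R v)\<bar> \<le> (\<integral>\<^sup>+s. ennreal (norm (Dw (x + s *\<^sub>R v))) \<partial>lborel)"
proof -
  have "ennreal \<bar>w (x + t *\<^sub>R v)\<bar>
      \<le> (\<integral>\<^sup>+s. ennreal (norm (Dw (x + s *\<^sub>R v))) * indicator {r..t} s \<partial>lborel)"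
    using abs_diff_line_le_nn_integral[OF der cont \<open>r \<le> t\<close>, of x v] assms by simp
  also have "\<dots> \<le> (\<integral>\<^sup>+s. ennreal (norm (Dw (x + s *\<^sub>R v))) \<partial>lborel)"
    by (intro nn_integral_mono) (auto simp: indicator_def)
  finally show ?thesis .
qed

lemma abs_le_nn_integral_coordinate_lines:
  fixes w :: "pt \<Rightarrow> real"
  assumes der: "\<And>x. (w has_derivative (\<lambda>h. Dw x \<bullet> h)) (at x)" and cont: "continuous_on UNIV Dw"
    and support: "\<And>x. norm x \<ge> R \<Longrightarrow> w x = 0"
  shows "ennreal \<bar>w (pt_of s t)\<bar> \<le> (\<integral>\<^sup>+s. ennreal (norm (Dw (pt_of s t))) \<partial>lborel)"
    and "ennreal \<bar>w (pt_of s t)\<bar> \<le> (\<integral>\<^sup>+t. ennreal (norm (Dw (pt_of s t))) \<partial>lborel)"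
proof -
  have zero: "w y = 0" if "y $ i = min c (- \<bar>R\<bar>)" for y c i
    using component_le_norm_cart[of y i] that by (intro support) linarith
  have "w (pt_of (min s (- \<bar>R\<bar>)) t) = 0" by (rule zero[of _ 1 s]) simp
  then show "ennreal \<bar>w (pt_of s t)\<bar> \<le> (\<integral>\<^sup>+s. ennreal (norm (Dw (pt_of s t))) \<partial>lborel)"
    using abs_le_nn_integral_line[OF der cont, of "axis 1 1" "t *\<^sub>R axis 2 1" "min s (- \<bar>R\<bar>)" s]
    by (simp add: pt_of_def add.commute)
  have "w (pt_of s (min t (- \<bar>R\<bar>))) = 0" by (rule zero[of _ 2 t]) simp
  then show "ennreal \<bar>w (pt_of s t)\<bar> \<le> (\<integral>\<^sup>+t. ennreal (norm (Dw (pt_of s t))) \<partial>lborel)"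
    using abs_le_nn_integral_line[OF der cont, of "axis 2 1" "s *\<^sub>R axis 1 1" "min t (- \<bar>R\<bar>)" t]
    by (simp add: pt_of_def)
qed

theorem Gagliardo_Nirenberg_plane:
  fixes w :: "pt \<Rightarrow> real"
  assumes der: "\<And>x. (w has_derivative (\<lambda>h. Dw x \<bullet> h)) (at x)" and cont: "continuous_on UNIV Dw"
    and support: "\<And>x. norm x \<ge> R \<Longrightarrow> w x = 0"
  shows "(\<integral>\<^sup>+x. ennreal ((w x)\<^sup>2) \<partial>lborel) \<le> (\<integral>\<^sup>+x. ennreal (norm (Dw x)) \<partial>lborel)\<^sup>2"
proof -
  have [measurable]: "Dw \<in> borel_measurable borel" using cont by (rule borel_measurable_continuous_onI)
  have "continuous_on UNIV w"
    by (intro continuous_at_imp_continuous_on ballI has_derivative_continuous[OF der])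
  then have [measurable]: "w \<in> borel_measurable borel" by (rule borel_measurable_continuous_onI)
  let ?horizontal = "\<lambda>t. \<integral>\<^sup>+s. ennreal (norm (Dw (pt_of s t))) \<partial>lborel"
  let ?vertical = "\<lambda>s. \<integral>\<^sup>+t. ennreal (norm (Dw (pt_of s t))) \<partial>lborel"
  have "(\<integral>\<^sup>+x. ennreal ((w x)\<^sup>2) \<partial>lborel) = (\<integral>\<^sup>+s. \<integral>\<^sup>+t. ennreal ((w (pt_of s t))\<^sup>2) \<partial>lborel \<partial>lborel)"
    by (rule nn_integral_pt_of) measurable
  also have "\<dots> \<le> (\<integral>\<^sup>+s. \<integral>\<^sup>+t. ?vertical s * ?horizontal t \<partial>lborel \<partial>lborel)"
  proof (intro nn_integral_mono)
    fix s t
    have "ennreal ((w (pt_of s t))\<^sup>2) = ennreal \<bar>w (pt_of s t)\<bar> * ennreal \<bar>w (pt_of s t)\<bar>"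
      by (simp add: power2_eq_square flip: ennreal_mult abs_mult)
    also have "\<dots> \<le> ?vertical s * ?horizontal t"
      by (intro mult_mono abs_le_nn_integral_coordinate_lines[OF der cont support]) auto
    finally show "ennreal ((w (pt_of s t))\<^sup>2) \<le> ?vertical s * ?horizontal t" .
  qed
  also have "\<dots> = (\<integral>\<^sup>+s. ?vertical s * (\<integral>\<^sup>+t. ?horizontal t \<partial>lborel) \<partial>lborel)"
    by (intro nn_integral_cong nn_integral_cmult) measurable
  also have "\<dots> = (\<integral>\<^sup>+s. ?vertical s \<partial>lborel) * (\<integral>\<^sup>+t. ?horizontal t \<partial>lborel)"
    by (rule nn_integral_multc) measurable
  also have "(\<integral>\<^sup>+s. ?vertical s \<partial>lborel) = (\<integral>\<^sup>+x. ennreal (norm (Dw x)) \<partial>lborel)"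
    by (rule nn_integral_pt_of[symmetric]) measurable
  also have "(\<integral>\<^sup>+t. ?horizontal t \<partial>lborel) = (\<integral>\<^sup>+x. ennreal (norm (Dw x)) \<partial>lborel)"
    by (rule nn_integral_pt_of_swap[symmetric]) measurable
  finally show ?thesis by (simp add: power2_eq_square)
qed

section \<open>Bounds for the nonlinear term\<close>

definition (in positive_potential) moment :: "nat \<Rightarrow> (pt \<Rightarrow> real) \<Rightarrow> ennreal" where
  "moment m u = (\<integral>\<^sup>+x. ennreal (V x * \<bar>u x\<bar> ^ m) \<partial>lborel)"

locale C1_potential = positive_potential +
  fixes DV :: "pt \<Rightarrow> pt" and C :: real
  assumes V_has_derivative: "\<And>x. (V has_derivative (\<lambda>h. DV x \<bullet> h)) (at x)"
    and DV_continuous: "continuous_on UNIV DV"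
    and C_nonneg: "C \<ge> 0"
    and norm_DV_le: "AE x in lborel. norm (DV x) \<le> C * V x powr (3/2)"
begin

definition sqrtV_power :: "nat \<Rightarrow> (pt \<Rightarrow> real) \<Rightarrow> pt \<Rightarrow> real" where
  "sqrtV_power k \<phi> x = sqrt (V x) * \<phi> x ^ Suc k"

definition grad_sqrtV_power :: "nat \<Rightarrow> (pt \<Rightarrow> real) \<Rightarrow> pt \<Rightarrow> pt" where
  "grad_sqrtV_power k \<phi> x = (\<phi> x ^ Suc k / (2 * sqrt (V x))) *\<^sub>R DV x
    + (real (Suc k) * \<phi> x ^ k * sqrt (V x)) *\<^sub>R grad \<phi> x"

lemma sqrtV_power_has_derivative:
  assumes "\<phi> \<in> test_fun"
  shows "(sqrtV_power k \<phi> has_derivative (\<lambda>h. grad_sqrtV_power k \<phi> x \<bullet> h)) (at x)"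
proof -
  have "((\<lambda>x. sqrt (V x)) has_derivative (\<lambda>h. DV x \<bullet> h * (1 / (2 * sqrt (V x))))) (at x)"
    using V_has_derivative[of x] V_pos[of x] by (auto intro!: derivative_eq_intros simp: field_simps)
  moreover have "((\<lambda>x. \<phi> x ^ Suc k) has_derivative (\<lambda>h. real (Suc k) * \<phi> x ^ k * (grad \<phi> x \<bullet> h))) (at x)"
    using has_derivative_power[OF test_fun_has_derivative[OF assms], where n = "Suc k"]
    by (rule has_derivative_eq_rhs) (auto simp: fun_eq_iff algebra_simps)
  ultimately have "(sqrtV_power k \<phi> has_derivative
      (\<lambda>h. sqrt (V x) * (real (Suc k) * \<phi> x ^ k * (grad \<phi> x \<bullet> h))
        + DV x \<bullet> h * (1 / (2 * sqrt (V x))) * \<phi> x ^ Suc k)) (at x)"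
    unfolding sqrtV_power_def[abs_def] by (rule has_derivative_mult)
  then show ?thesis
    by (rule has_derivative_eq_rhs) (simp add: fun_eq_iff grad_sqrtV_power_def inner_add_left)
qed

lemma sqrtV_power_sq: "(sqrtV_power k \<phi> x)\<^sup>2 = V x * \<bar>\<phi> x\<bar> ^ (2 * Suc k)"
  by (simp add: sqrtV_power_def power_mult_distrib power_even_eq flip: power_abs
      del: power_Suc mult_Suc_right)

lemma continuous_grad_sqrtV_power:
  assumes "\<phi> \<in> test_fun"
  shows "continuous_on UNIV (grad_sqrtV_power k \<phi>)"
proof -
  have "sqrt (V x) \<noteq> 0" for x using V_pos[of x] by simp
  then show ?thesis
    unfolding grad_sqrtV_power_def[abs_def]
    by (intro continuous_intros V_continuous DV_continuous test_fun_continuous[OF assms]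
        test_fun_continuous_grad[OF assms]) auto
qed

text \<open>The hypothesis on \<open>\<nabla>V\<close> is exactly what makes the gradient of \<open>\<surd>V\<close> contribute a multiple of \<open>V\<close>.\<close>

lemma norm_grad_sqrtV_power_le:
  assumes DV: "norm (DV x) \<le> C * V x powr (3/2)"
  shows "norm (grad_sqrtV_power k \<phi> x)
    \<le> (C / 2 + real (Suc k)) * ((sqrt (V x) * \<bar>\<phi> x\<bar> ^ k) * norm (weighted_pair V (test_pair \<phi>) x))"
proof -
  let ?N = "norm (weighted_pair V (test_pair \<phi>) x)" and ?a = "sqrt (V x) * \<bar>\<phi> x\<bar> ^ k"
  have "V x powr (3/2) = V x * sqrt (V x)"
    using V_pos[of x] powr_add[of "V x" 1 "1/2"] by (simp add: powr_half_sqrt)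
  also have "\<dots> = sqrt (V x) * sqrt (V x) * sqrt (V x)" by simp
  finally have DV_sqrt: "norm (DV x) \<le> C * (sqrt (V x) * sqrt (V x) * sqrt (V x))" using DV by simp
  have "norm (grad_sqrtV_power k \<phi> x)
      \<le> \<bar>\<phi> x\<bar> ^ Suc k / (2 * sqrt (V x)) * norm (DV x)
        + real (Suc k) * \<bar>\<phi> x\<bar> ^ k * sqrt (V x) * norm (grad \<phi> x)"
    unfolding grad_sqrtV_power_def
    by (rule order.trans[OF norm_triangle_ineq]) (simp add: abs_mult power_abs)
  also have "\<bar>\<phi> x\<bar> ^ Suc k / (2 * sqrt (V x)) * norm (DV x)
      \<le> \<bar>\<phi> x\<bar> ^ Suc k / (2 * sqrt (V x)) * (C * (sqrt (V x) * sqrt (V x) * sqrt (V x)))"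
    by (intro mult_left_mono DV_sqrt) simp
  also have "\<dots> = C / 2 * (?a * (sqrt (V x) * \<bar>\<phi> x\<bar>))"
    using V_pos[of x] by (simp add: field_simps del: real_sqrt_mult_self)
  also have "\<dots> \<le> C / 2 * (?a * ?N)"
    using norm_fst_le[of "sqrt (V x) * \<phi> x" "grad \<phi> x"] C_nonneg
    by (intro mult_left_mono) (auto simp: weighted_pair_def abs_mult)
  also have "real (Suc k) * \<bar>\<phi> x\<bar> ^ k * sqrt (V x) * norm (grad \<phi> x)
      = real (Suc k) * (?a * norm (grad \<phi> x))"
    by simp
  also have "\<dots> \<le> real (Suc k) * (?a * ?N)"
    using norm_snd_le[of "grad \<phi> x" "sqrt (V x) * \<phi> x"]
    by (intro mult_left_mono) (auto simp: weighted_pair_def)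
  finally show ?thesis by (simp add: distrib_right)
qed

lemma test_fun_moment_step:
  assumes \<phi>: "\<phi> \<in> test_fun"
  shows "moment (2 * Suc k) \<phi>
    \<le> ennreal ((C / 2 + real (Suc k))\<^sup>2) * (moment (2 * k) \<phi> * ennreal (normV_sq V (test_pair \<phi>)))"
proof -
  let ?a = "\<lambda>x. sqrt (V x) * \<bar>\<phi> x\<bar> ^ k" and ?b = "\<lambda>x. norm (weighted_pair V (test_pair \<phi>) x)"
    and ?c = "C / 2 + real (Suc k)"
  note pair = test_pair_in_H1V[OF \<phi>]
  note [measurable] = borel_measurable_test_fun(1)[OF \<phi>]
  have [measurable]: "weighted_pair V (test_pair \<phi>) \<in> borel_measurable borel"
    using borel_measurable_square_integrable[OF square_integrable_H1V[OF pair]] by simp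
  obtain R where R: "\<And>x. norm x \<ge> R \<Longrightarrow> \<phi> x = 0" using test_fun_support[OF \<phi>] by metis
  have "moment (2 * Suc k) \<phi> = (\<integral>\<^sup>+x. ennreal ((sqrtV_power k \<phi> x)\<^sup>2) \<partial>lborel)"
    by (simp only: moment_def sqrtV_power_sq)
  also have "\<dots> \<le> (\<integral>\<^sup>+x. ennreal (norm (grad_sqrtV_power k \<phi> x)) \<partial>lborel)\<^sup>2"
    by (rule Gagliardo_Nirenberg_plane[OF sqrtV_power_has_derivative[OF \<phi>]
          continuous_grad_sqrtV_power[OF \<phi>], of R])
      (simp add: sqrtV_power_def R)
  also have "\<dots> \<le> (\<integral>\<^sup>+x. ennreal ?c * (ennreal (?a x) * ennreal (?b x)) \<partial>lborel)\<^sup>2"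
  proof (intro power_mono nn_integral_mono_AE)
    show "AE x in lborel. ennreal (norm (grad_sqrtV_power k \<phi> x))
        \<le> ennreal ?c * (ennreal (?a x) * ennreal (?b x))"
      using norm_DV_le
    proof eventually_elim
      case (elim x)
      from ennreal_leI[OF norm_grad_sqrtV_power_le[OF this, of k \<phi>]] C_nonneg
      show ?case by (simp add: ennreal_mult)
    qed
  qed simp
  also have "\<dots> = (ennreal ?c * (\<integral>\<^sup>+x. ennreal (?a x) * ennreal (?b x) \<partial>lborel))\<^sup>2"
    by (subst nn_integral_cmult) simp_all
  also have "\<dots> = ennreal (?c\<^sup>2) * (\<integral>\<^sup>+x. ennreal (?a x) * ennreal (?b x) \<partial>lborel)\<^sup>2"
    using C_nonneg by (subst power_mult_distrib, subst ennreal_power) auto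
  also have "\<dots> \<le> ennreal (?c\<^sup>2) *
      ((\<integral>\<^sup>+x. (ennreal (?a x))\<^sup>2 \<partial>lborel) * (\<integral>\<^sup>+x. (ennreal (?b x))\<^sup>2 \<partial>lborel))"
    by (intro mult_left_mono Cauchy_Schwarz_nn_integral) auto
  also have "(\<integral>\<^sup>+x. (ennreal (?a x))\<^sup>2 \<partial>lborel) = moment (2 * k) \<phi>"
    unfolding moment_def by (simp add: ennreal_power power_mult_distrib power_even_eq)
  also have "(\<integral>\<^sup>+x. (ennreal (?b x))\<^sup>2 \<partial>lborel) = ennreal (normV_sq V (test_pair \<phi>))"
    by (simp add: ennreal_power nn_integral_weighted_pair[OF pair])
  finally show ?thesis .
qed

definition moment_const :: "nat \<Rightarrow> real" where
  "moment_const k = (\<Prod>j<k. (C / 2 + real (j + 2))\<^sup>2)"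

lemma moment_const_nonneg: "0 \<le> moment_const k"
  by (simp add: moment_const_def prod_nonneg)

lemma test_fun_moment_le:
  assumes \<phi>: "\<phi> \<in> test_fun"
  shows "moment (2 * Suc k) \<phi> \<le> ennreal (moment_const k * normV_sq V (test_pair \<phi>) ^ Suc k)"
proof (induct k)
  case 0
  have "moment 2 \<phi> \<le> (\<integral>\<^sup>+x. ennreal ((norm (weighted_pair V (test_pair \<phi>) x))\<^sup>2) \<partial>lborel)"
    unfolding moment_def by (intro nn_integral_mono ennreal_leI) (simp add: norm_weighted_pair)
  then show ?case by (simp add: moment_const_def nn_integral_weighted_pair[OF test_pair_in_H1V[OF \<phi>]])
next
  case (Suc k)
  let ?N = "normV_sq V (test_pair \<phi>)" and ?c = "(C / 2 + real (k + 2))\<^sup>2"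
  have N_nonneg: "0 \<le> ?N" by (intro normV_sq_nonneg test_pair_in_H1V \<phi>)
  have "moment (2 * Suc (Suc k)) \<phi> \<le> ennreal ?c * (moment (2 * Suc k) \<phi> * ennreal ?N)"
    using test_fun_moment_step[OF \<phi>, of "Suc k"] by simp
  also have "\<dots> \<le> ennreal ?c * (ennreal (moment_const k * ?N ^ Suc k) * ennreal ?N)"
    by (intro mult_left_mono mult_right_mono Suc) auto
  also have "\<dots> = ennreal (?c * (moment_const k * ?N ^ Suc k * ?N))"
    using N_nonneg moment_const_nonneg[of k] by (simp add: ennreal_mult)
  also have "?c * (moment_const k * ?N ^ Suc k * ?N) = moment_const (Suc k) * ?N ^ Suc (Suc k)"
    by (simp add: moment_const_def)
  finally show ?case .
qed

lemma H1V_moment_le: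
  assumes v: "v \<in> H1V V"
  shows "moment (2 * Suc k) (fst v) \<le> ennreal (moment_const k * normV_sq V v ^ Suc k)"
proof -
  obtain \<phi> where \<phi>: "\<And>n. \<phi> n \<in> test_fun"
    and lim: "(\<lambda>n. normV_sq V (test_pair (\<phi> n))) \<longlonglongrightarrow> normV_sq V v"
    and lim_AE: "AE x in lborel. (\<lambda>n. \<phi> n x) \<longlonglongrightarrow> fst v x"
    using H1V_test_sequence[OF v] by blast
  note [measurable] = borel_measurable_test_fun(1)[OF \<phi>]
  show ?thesis
    unfolding moment_def
  proof (rule nn_integral_le_of_AE_tendsto)
    show "AE x in lborel. (\<lambda>n. V x * \<bar>\<phi> n x\<bar> ^ (2 * Suc k)) \<longlonglongrightarrow> V x * \<bar>fst v x\<bar> ^ (2 * Suc k)"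
      using lim_AE by eventually_elim (intro tendsto_intros)
    show "(\<integral>\<^sup>+x. ennreal (V x * \<bar>\<phi> n x\<bar> ^ (2 * Suc k)) \<partial>lborel)
        \<le> ennreal (moment_const k * normV_sq V (test_pair (\<phi> n)) ^ Suc k)" for n
      using test_fun_moment_le[OF \<phi>] by (simp only: moment_def)
    show "(\<lambda>n. ennreal (moment_const k * normV_sq V (test_pair (\<phi> n)) ^ Suc k))
        \<longlonglongrightarrow> ennreal (moment_const k * normV_sq V v ^ Suc k)"
      by (intro tendsto_ennrealI tendsto_intros lim)
  qed measurable
qed

end

lemma powr_le_sum_powers:
  fixes y r :: real
  assumes "0 \<le> y" "2 \<le> r" "r \<le> real n"
  shows "y powr r \<le> y\<^sup>2 + y ^ n"
proof (cases "y = 0")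
  case False
  then have y: "y > 0" using assms(1) by simp
  show ?thesis
  proof (cases "y \<le> 1")
    case True
    then have "y powr r \<le> y powr 2" using assms y by (intro powr_mono') auto
    then show ?thesis using y by (simp add: add_increasing2)
  next
    case False
    then have "y powr r \<le> y powr real n" using assms by (intro powr_mono) auto
    then show ?thesis using y by (simp add: powr_realpow add_increasing)
  qed
qed simp

context C1_potential
begin

lemma nonlin_le:
  assumes v: "v \<in> H1V V" and p: "1 \<le> p" "p + 1 \<le> real (2 * Suc k)"
  shows "nonlin p V (fst v) \<le> normV_sq V v + moment_const k * normV_sq V v ^ Suc k"
proof -
  note nonneg = normV_sq_nonneg[OF v] moment_const_nonneg[of k]
  have [measurable]: "fst v \<in> borel_measurable borel" by (rule borel_measurable_H1V(1)[OF v])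
  have [measurable]: "weighted_pair V v \<in> borel_measurable borel"
    using borel_measurable_square_integrable[OF square_integrable_H1V[OF v]] by simp
  have "(\<integral>\<^sup>+x. ennreal (V x * \<bar>fst v x\<bar> powr (p + 1)) \<partial>lborel)
      \<le> (\<integral>\<^sup>+x. ennreal ((norm (weighted_pair V v x))\<^sup>2)
          + ennreal (V x * \<bar>fst v x\<bar> ^ (2 * Suc k)) \<partial>lborel)"
  proof (rule nn_integral_mono)
    fix x
    have "V x * \<bar>fst v x\<bar> powr (p + 1) \<le> V x * (\<bar>fst v x\<bar>\<^sup>2 + \<bar>fst v x\<bar> ^ (2 * Suc k))"
      using p by (intro mult_left_mono powr_le_sum_powers) auto
    also have "\<dots> \<le> (norm (weighted_pair V v x))\<^sup>2 + V x * \<bar>fst v x\<bar> ^ (2 * Suc k)"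
      by (simp add: norm_weighted_pair distrib_left)
    finally show "ennreal (V x * \<bar>fst v x\<bar> powr (p + 1))
        \<le> ennreal ((norm (weighted_pair V v x))\<^sup>2) + ennreal (V x * \<bar>fst v x\<bar> ^ (2 * Suc k))"
      by (simp add: ennreal_leI flip: ennreal_plus del: power_Suc)
  qed
  also have "\<dots> = ennreal (normV_sq V v) + moment (2 * Suc k) (fst v)"
    unfolding moment_def nn_integral_weighted_pair[OF v, symmetric] by (intro nn_integral_add) measurable
  also have "\<dots> \<le> ennreal (normV_sq V v) + ennreal (moment_const k * normV_sq V v ^ Suc k)"
    by (intro add_left_mono H1V_moment_le v)
  also have "\<dots> = ennreal (normV_sq V v + moment_const k * normV_sq V v ^ Suc k)"
    using nonneg by (simp flip: ennreal_plus)
  finally have "enn2real (\<integral>\<^sup>+x. ennreal (V x * \<bar>fst v x\<bar> powr (p + 1)) \<partial>lborel)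
      \<le> normV_sq V v + moment_const k * normV_sq V v ^ Suc k"
    using nonneg by (intro enn2real_leI) auto
  then show ?thesis unfolding nonlin_def by (subst integral_eq_nn_integral) auto
qed

lemma nonlin_bound:
  assumes "1 \<le> p" "0 \<le> K"
  obtains D where "D > 0" "\<And>v. v \<in> H1V V \<Longrightarrow> normV_sq V v \<le> K \<Longrightarrow> nonlin p V (fst v) \<le> D * normV_sq V v"
proof -
  obtain k :: nat where "p + 1 \<le> real k" using real_arch_simple by blast
  then have k: "p + 1 \<le> real (2 * Suc k)" by simp
  have "nonlin p V (fst v) \<le> (1 + moment_const k * K ^ k) * normV_sq V v"
    if v: "v \<in> H1V V" and bounded: "normV_sq V v \<le> K" for v
  proof -
    have "nonlin p V (fst v) \<le> (1 + moment_const k * normV_sq V v ^ k) * normV_sq V v"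
      using nonlin_le[OF v \<open>1 \<le> p\<close> k] by (simp add: algebra_simps)
    also have "\<dots> \<le> (1 + moment_const k * K ^ k) * normV_sq V v"
      using normV_sq_nonneg[OF v] bounded moment_const_nonneg
      by (intro mult_right_mono add_left_mono mult_left_mono power_mono) auto
    finally show ?thesis .
  qed
  moreover have "1 + moment_const k * K ^ k > 0"
    using moment_const_nonneg[of k] \<open>0 \<le> K\<close> by (intro add_pos_nonneg mult_nonneg_nonneg) auto
  ultimately show thesis using that by blast
qed

end

section \<open>Translations, ball averages and strong convergence in \<open>L\<^sup>2\<close>\<close>

declare borel_closed[OF closed_cball, measurable]

lemma nn_integral_lborel_shift:
  fixes f :: "'a::euclidean_space \<Rightarrow> ennreal"
  assumes "f \<in> borel_measurable borel"
  shows "(\<integral>\<^sup>+x. f (c + x) \<partial>lborel) = (\<integral>\<^sup>+x. f x \<partial>lborel)"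
  using nn_integral_distr[of "(+) c" lborel borel f] assms by (simp add: lborel_distr_plus)

lemma AE_lborel_shift:
  fixes c :: "'a::euclidean_space"
  assumes "AE x in lborel. P x"
  shows "AE x in lborel. P (c + x)"
  using AE_distrD[of "(+) c" lborel borel P] assms unfolding lborel_distr_plus by simp

lemma translation_diff_sq_le_nn_integral_line:
  fixes f :: "'a::euclidean_space \<Rightarrow> real"
  assumes der: "\<And>x. (f has_derivative (\<lambda>h. Df x \<bullet> h)) (at x)" and cont: "continuous_on UNIV Df"
  shows "ennreal ((f (z + x) - f x)\<^sup>2)
    \<le> (\<integral>\<^sup>+t. ennreal ((norm z)\<^sup>2 * (norm (Df (t *\<^sub>R z + x)))\<^sup>2) * indicator {0..1} t \<partial>lborel)"
proof -
  have [measurable]: "Df \<in> borel_measurable borel" using cont by (rule borel_measurable_continuous_onI)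
  let ?I = "indicator {0..1::real} :: real \<Rightarrow> ennreal"
  let ?g = "\<lambda>t. ennreal (norm z * norm (Df (t *\<^sub>R z + x)))"
  have "ennreal \<bar>f (z + x) - f x\<bar> \<le> (\<integral>\<^sup>+t. ?g t * ?I t \<partial>lborel)"
    using abs_diff_line_le_nn_integral[OF der cont, of 0 1 x z] by (simp add: add.commute)
  also have "\<dots> = (\<integral>\<^sup>+t. (?g t * ?I t) * ?I t \<partial>lborel)"
    by (intro nn_integral_cong) (simp add: indicator_def)
  finally have "(ennreal \<bar>f (z + x) - f x\<bar>)\<^sup>2 \<le> (\<integral>\<^sup>+t. (?g t * ?I t) * ?I t \<partial>lborel)\<^sup>2"
    by (intro power_mono) auto
  also have "\<dots> \<le> (\<integral>\<^sup>+t. (?g t * ?I t)\<^sup>2 \<partial>lborel) * (\<integral>\<^sup>+t. (?I t)\<^sup>2 \<partial>lborel)"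
    by (rule Cauchy_Schwarz_nn_integral) measurable
  also have "(\<integral>\<^sup>+t. (?I t)\<^sup>2 \<partial>lborel) = (\<integral>\<^sup>+t. ?I t \<partial>lborel)"
    by (intro nn_integral_cong) (simp add: indicator_def)
  also have "(\<integral>\<^sup>+t. (?g t * ?I t)\<^sup>2 \<partial>lborel)
      = (\<integral>\<^sup>+t. ennreal ((norm z)\<^sup>2 * (norm (Df (t *\<^sub>R z + x)))\<^sup>2) * ?I t \<partial>lborel)"
    by (intro nn_integral_cong) (simp add: indicator_def ennreal_power power_mult_distrib)
  finally show ?thesis by (simp add: ennreal_power)
qed

lemma nn_integral_translation_diff_sq_le:
  fixes f :: "'a::euclidean_space \<Rightarrow> real"
  assumes der: "\<And>x. (f has_derivative (\<lambda>h. Df x \<bullet> h)) (at x)" and cont: "continuous_on UNIV Df"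
  shows "(\<integral>\<^sup>+x. ennreal ((f (z + x) - f x)\<^sup>2) \<partial>lborel)
    \<le> ennreal ((norm z)\<^sup>2) * (\<integral>\<^sup>+x. ennreal ((norm (Df x))\<^sup>2) \<partial>lborel)"
proof -
  have [measurable]: "Df \<in> borel_measurable borel" using cont by (rule borel_measurable_continuous_onI)
  let ?h = "\<lambda>x. ennreal ((norm z)\<^sup>2 * (norm (Df x))\<^sup>2)"
  have "(\<integral>\<^sup>+x. ennreal ((f (z + x) - f x)\<^sup>2) \<partial>lborel)
      \<le> (\<integral>\<^sup>+x. \<integral>\<^sup>+t. ?h (t *\<^sub>R z + x) * indicator {0..1} t \<partial>lborel \<partial>lborel)"
    by (intro nn_integral_mono translation_diff_sq_le_nn_integral_line[OF der cont])
  also have "\<dots> = (\<integral>\<^sup>+t. \<integral>\<^sup>+x. ?h (t *\<^sub>R z + x) * indicator {0..1} t \<partial>lborel \<partial>lborel)"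
    by (rule lborel_pair.Fubini') measurable
  also have "\<dots> = (\<integral>\<^sup>+t. (\<integral>\<^sup>+x. ?h x \<partial>lborel) * indicator {0..1::real} t \<partial>lborel)"
    by (simp add: nn_integral_multc nn_integral_lborel_shift[of ?h])
  also have "\<dots> = (\<integral>\<^sup>+x. ?h x \<partial>lborel)" by (simp add: nn_integral_cmult)
  also have "\<dots> = ennreal ((norm z)\<^sup>2) * (\<integral>\<^sup>+x. ennreal ((norm (Df x))\<^sup>2) \<partial>lborel)"
    by (simp add: ennreal_mult nn_integral_cmult)
  finally show ?thesis .
qed

lemma set_integral_sq_le:
  fixes u :: "'a \<Rightarrow> real"
  assumes [measurable]: "u \<in> borel_measurable M" "A \<in> sets M"
  shows "ennreal ((LINT x:A|M. u x)\<^sup>2) \<le> emeasure M A * (\<integral>\<^sup>+x\<in>A. ennreal ((u x)\<^sup>2) \<partial>M)"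
proof -
  let ?I = "indicator A :: 'a \<Rightarrow> ennreal"
  have "ennreal \<bar>LINT x:A|M. u x\<bar> \<le> (\<integral>\<^sup>+x. ennreal \<bar>u x\<bar> * ?I x * ?I x \<partial>M)"
  proof (cases "set_integrable M A u")
    case True
    then have "ennreal (norm (LINT x:A|M. u x)) \<le> (\<integral>\<^sup>+x. ennreal (norm (indicator A x *\<^sub>R u x)) \<partial>M)"
      unfolding set_lebesgue_integral_def set_integrable_def by (rule integral_norm_bound_ennreal)
    also have "\<dots> = (\<integral>\<^sup>+x. ennreal \<bar>u x\<bar> * ?I x * ?I x \<partial>M)"
      by (intro nn_integral_cong) (simp add: indicator_def)
    finally show ?thesis by simp
  qed (simp add: set_lebesgue_integral_def set_integrable_def not_integrable_integral_eq)
  then have "(ennreal \<bar>LINT x:A|M. u x\<bar>)\<^sup>2 \<le> (\<integral>\<^sup>+x. ennreal \<bar>u x\<bar> * ?I x * ?I x \<partial>M)\<^sup>2"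
    by (rule power_mono) simp
  also have "\<dots> \<le> (\<integral>\<^sup>+x. (ennreal \<bar>u x\<bar> * ?I x)\<^sup>2 \<partial>M) * (\<integral>\<^sup>+x. (?I x)\<^sup>2 \<partial>M)"
    by (rule Cauchy_Schwarz_nn_integral) measurable
  also have "(\<integral>\<^sup>+x. (?I x)\<^sup>2 \<partial>M) = (\<integral>\<^sup>+x. ?I x \<partial>M)"
    by (intro nn_integral_cong) (simp add: indicator_def)
  also have "(\<integral>\<^sup>+x. (ennreal \<bar>u x\<bar> * ?I x)\<^sup>2 \<partial>M) = (\<integral>\<^sup>+x\<in>A. ennreal ((u x)\<^sup>2) \<partial>M)"
    by (intro nn_integral_cong) (simp add: indicator_def ennreal_power)
  finally show ?thesis by (simp add: ennreal_power mult.commute)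
qed

definition ball_average :: "real \<Rightarrow> ('a::euclidean_space \<Rightarrow> real) \<Rightarrow> 'a \<Rightarrow> real" where
  "ball_average h u x = (LINT y:cball x h|lborel. u y) / measure lborel (cball (0::'a) h)"

lemma emeasure_cball_eq_content:
  fixes x :: "'a::euclidean_space"
  assumes "h > 0"
  shows "emeasure lborel (cball x h) = ennreal (measure lborel (cball (0::'a) h))"
proof -
  have "measure lborel (cball x h) = measure lborel (cball (0::'a) h)"
    using assms by (simp add: content_cball)
  then show ?thesis
    using emeasure_lborel_cball_finite[of x h] by (simp add: emeasure_eq_ennreal_measure)
qed

lemma square_integrable_indicator:
  assumes "A \<in> sets M" "emeasure M A < \<infinity>"
  shows "square_integrable M (indicator A :: 'a \<Rightarrow> real)"
proof -
  have "(\<lambda>x. (norm (indicator A x :: real))\<^sup>2) = indicator A" by (auto simp: indicator_def)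
  then show ?thesis using assms by (auto simp: square_integrable_def)
qed

lemma square_integrable_cball:
  fixes x :: "'a::euclidean_space"
  shows "square_integrable lborel (indicator (cball x h) :: 'a \<Rightarrow> real)"
  using emeasure_lborel_cball_finite[of x h] by (intro square_integrable_indicator) auto

lemma set_integrable_cball:
  fixes u :: "'a::euclidean_space \<Rightarrow> real"
  assumes "square_integrable lborel u"
  shows "set_integrable lborel (cball x h) u"
  using integrable_inner_square_integrable[OF square_integrable_cball assms]
  by (simp add: set_integrable_def)

lemma borel_measurable_ball_average [measurable]:
  fixes u :: "'a::euclidean_space \<Rightarrow> real"
  assumes [measurable]: "u \<in> borel_measurable borel"
  shows "ball_average h u \<in> borel_measurable borel"
proof -
  have "(\<lambda>x. \<integral>y. (if dist x y \<le> h then 1 else 0) * u y \<partial>lborel) \<in> borel_measurable borel"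
    by (rule lborel.borel_measurable_lebesgue_integral) measurable
  moreover have "indicator (cball x h) y = (if dist x y \<le> h then 1 else (0::real))" for x y :: 'a
    by (simp add: indicator_def)
  ultimately show ?thesis
    unfolding ball_average_def[abs_def] set_lebesgue_integral_def
    by simp
qed

lemma ball_average_sq_le:
  fixes u :: "'a::euclidean_space \<Rightarrow> real"
  assumes u: "u \<in> borel_measurable borel" and h: "h > 0"
  shows "ennreal (measure lborel (cball (0::'a) h)) * ennreal ((ball_average h u x)\<^sup>2)
    \<le> (\<integral>\<^sup>+y\<in>cball x h. ennreal ((u y)\<^sup>2) \<partial>lborel)"
proof -
  let ?c = "measure lborel (cball (0::'a) h)"
  have "?c > 0" using content_cball_pos[OF h] by simp
  have "(LINT y:cball x h|lborel. u y) = ?c * ball_average h u x"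
    using \<open>?c > 0\<close> by (simp add: ball_average_def)
  then have "(LINT y:cball x h|lborel. u y)\<^sup>2 = ?c * (?c * (ball_average h u x)\<^sup>2)"
    by (simp add: power2_eq_square ac_simps)
  then have "ennreal ?c * (ennreal ?c * ennreal ((ball_average h u x)\<^sup>2))
      \<le> ennreal ?c * (\<integral>\<^sup>+y\<in>cball x h. ennreal ((u y)\<^sup>2) \<partial>lborel)"
    using set_integral_sq_le[of u lborel "cball x h"] u \<open>?c > 0\<close>
    by (simp add: emeasure_cball_eq_content[OF h] ennreal_mult')
  then show ?thesis using \<open>?c > 0\<close> by (simp add: ennreal_mult_le_mult_iff)
qed

lemma ball_average_diff_const:
  fixes u :: "'a::euclidean_space \<Rightarrow> real"
  assumes "square_integrable lborel u" and h: "h > 0"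
  shows "ball_average h (\<lambda>y. u y - a) x = ball_average h u x - a"
proof -
  have "set_integrable lborel (cball x h) (\<lambda>_. a)"
    using emeasure_lborel_cball_finite[of x h] by (simp add: set_integrable_def)
  moreover have "(LINT y:cball x h|lborel. a) = measure lborel (cball (0::'a) h) * a"
    using h by (simp add: set_lebesgue_integral_def content_cball)
  ultimately show ?thesis
    using set_integrable_cball[OF assms(1)] content_cball_pos[OF h]
    by (simp add: ball_average_def set_integral_diff diff_divide_distrib)
qed

lemma nn_integral_ball_average_diff_sq_le:
  fixes u :: "'a::euclidean_space \<Rightarrow> real"
  assumes u: "square_integrable lborel u" and h: "h > 0"
    and translation: "\<And>z. norm z \<le> h \<Longrightarrow> (\<integral>\<^sup>+x. ennreal ((u (z + x) - u x)\<^sup>2) \<partial>lborel) \<le> B"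
  shows "(\<integral>\<^sup>+x. ennreal ((ball_average h u x - u x)\<^sup>2) \<partial>lborel) \<le> B"
proof -
  let ?c = "ennreal (measure lborel (cball (0::'a) h))"
  let ?I = "\<lambda>z. indicator (cball (0::'a) h) z :: ennreal"
  have [measurable]: "u \<in> borel_measurable borel" using borel_measurable_square_integrable[OF u] by simp
  have "?c * (\<integral>\<^sup>+x. ennreal ((ball_average h u x - u x)\<^sup>2) \<partial>lborel)
      = (\<integral>\<^sup>+x. ?c * ennreal ((ball_average h u x - u x)\<^sup>2) \<partial>lborel)"
    by (rule nn_integral_cmult[symmetric]) measurable
  also have "\<dots> \<le> (\<integral>\<^sup>+x. \<integral>\<^sup>+z. ennreal ((u (z + x) - u x)\<^sup>2) * ?I z \<partial>lborel \<partial>lborel)"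
  proof (rule nn_integral_mono)
    fix x :: 'a
    have shift: "indicator (cball x h) (x + z) = ?I z" for z by (simp add: indicator_def dist_norm)
    have "?c * ennreal ((ball_average h u x - u x)\<^sup>2)
        \<le> (\<integral>\<^sup>+y\<in>cball x h. ennreal ((u y - u x)\<^sup>2) \<partial>lborel)"
      using ball_average_sq_le[of "\<lambda>y. u y - u x" h x] h by (simp add: ball_average_diff_const[OF u h])
    also have "\<dots> = (\<integral>\<^sup>+z. ennreal ((u (x + z) - u x)\<^sup>2) * indicator (cball x h) (x + z) \<partial>lborel)"
      by (rule nn_integral_lborel_shift[symmetric]) measurable
    also have "\<dots> = (\<integral>\<^sup>+z. ennreal ((u (z + x) - u x)\<^sup>2) * ?I z \<partial>lborel)"
      unfolding shift by (simp only: add.commute)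
    finally show "?c * ennreal ((ball_average h u x - u x)\<^sup>2)
        \<le> (\<integral>\<^sup>+z. ennreal ((u (z + x) - u x)\<^sup>2) * ?I z \<partial>lborel)" .
  qed
  also have "\<dots> = (\<integral>\<^sup>+z. \<integral>\<^sup>+x. ennreal ((u (z + x) - u x)\<^sup>2) * ?I z \<partial>lborel \<partial>lborel)"
    by (rule lborel_pair.Fubini') measurable
  also have "\<dots> \<le> (\<integral>\<^sup>+z. B * ?I z \<partial>lborel)"
    using translation by (intro nn_integral_mono) (auto simp: nn_integral_multc indicator_def)
  also have "\<dots> = B * ?c"
    by (simp add: nn_integral_cmult_indicator emeasure_cball_eq_content[OF h])
  finally show ?thesis
    using content_cball_pos[OF h] by (simp add: mult.commute[of B] ennreal_mult_le_mult_iff)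
qed

lemma ball_average_sq_le_of_L2_bound:
  fixes u :: "'a::euclidean_space \<Rightarrow> real"
  assumes u: "u \<in> borel_measurable borel" and h: "h > 0"
    and bound: "(\<integral>\<^sup>+y. ennreal ((u y)\<^sup>2) \<partial>lborel) \<le> ennreal K"
  shows "ennreal ((ball_average h u x)\<^sup>2) \<le> ennreal (K / measure lborel (cball (0::'a) h))"
proof -
  let ?c = "measure lborel (cball (0::'a) h)"
  have "?c > 0" using content_cball_pos[OF h] by simp
  have "ennreal ?c * ennreal ((ball_average h u x)\<^sup>2) \<le> (\<integral>\<^sup>+y\<in>cball x h. ennreal ((u y)\<^sup>2) \<partial>lborel)"
    by (rule ball_average_sq_le[OF u h])
  also have "\<dots> \<le> (\<integral>\<^sup>+y. ennreal ((u y)\<^sup>2) \<partial>lborel)"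
    by (intro nn_integral_mono) (simp add: indicator_def)
  also have "\<dots> \<le> ennreal K" by (rule bound)
  also have "\<dots> = ennreal ?c * ennreal (K / ?c)"
    using \<open>?c > 0\<close> by (simp flip: ennreal_mult')
  finally show ?thesis using \<open>?c > 0\<close> by (simp add: ennreal_mult_le_mult_iff)
qed

lemma weakly_null_ball_average_tendsto_0:
  fixes u :: "nat \<Rightarrow> 'a::euclidean_space \<Rightarrow> real"
  assumes h: "h > 0"
    and weak: "\<And>f. square_integrable lborel f \<Longrightarrow> (\<lambda>n. \<integral>y. u n y * f y \<partial>lborel) \<longlonglongrightarrow> 0"
  shows "(\<lambda>n. ball_average h (u n) x) \<longlonglongrightarrow> 0"
proof -
  let ?c = "measure lborel (cball (0::'a) h)"
  have "(\<lambda>n. (\<integral>y. u n y * indicator (cball x h) y \<partial>lborel) / ?c) \<longlonglongrightarrow> 0 / ?c"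
    using content_cball_pos[OF h]
    by (intro tendsto_divide weak square_integrable_cball tendsto_const) simp
  moreover have "ball_average h (u n) x = (\<integral>y. u n y * indicator (cball x h) y \<partial>lborel) / ?c" for n
    by (simp add: ball_average_def set_lebesgue_integral_def mult.commute)
  ultimately show ?thesis by simp
qed

lemma weakly_null_ball_average_L2_null_on_cball:
  fixes u :: "nat \<Rightarrow> 'a::euclidean_space \<Rightarrow> real"
  assumes u [measurable]: "\<And>n. u n \<in> borel_measurable borel" and h: "h > 0"
    and bound: "\<And>n. (\<integral>\<^sup>+x. ennreal ((u n x)\<^sup>2) \<partial>lborel) \<le> ennreal K"
    and weak: "\<And>f. square_integrable lborel f \<Longrightarrow> (\<lambda>n. \<integral>x. u n x * f x \<partial>lborel) \<longlonglongrightarrow> 0"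
  shows "(\<lambda>n. \<integral>\<^sup>+x\<in>cball 0 R. ennreal ((ball_average h (u n) x)\<^sup>2) \<partial>lborel) \<longlonglongrightarrow> 0"
proof -
  let ?bound = "ennreal (K / measure lborel (cball (0::'a) h))"
  have "(\<lambda>n. \<integral>\<^sup>+x. ennreal ((ball_average h (u n) x)\<^sup>2) * indicator (cball 0 R) x \<partial>lborel)
      \<longlonglongrightarrow> (\<integral>\<^sup>+x. 0 \<partial>(lborel :: 'a measure))"
  proof (rule nn_integral_dominated_convergence)
    show "AE x in lborel. ennreal ((ball_average h (u n) x)\<^sup>2) * indicator (cball 0 R) x
        \<le> ?bound * indicator (cball 0 R) x" for n
      by (intro AE_I2 mult_right_mono ball_average_sq_le_of_L2_bound[OF u h bound]) simp
    show "(\<integral>\<^sup>+x. ?bound * indicator (cball (0::'a) R) x \<partial>lborel) < \<infinity>"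
      using emeasure_lborel_cball_finite[of "0::'a" R]
      by (simp add: nn_integral_cmult_indicator ennreal_mult_less_top)
    have "(\<lambda>n. ennreal ((ball_average h (u n) x)\<^sup>2) * indicator (cball 0 R) x) \<longlonglongrightarrow> 0" for x
    proof (cases "x \<in> cball 0 R")
      case True
      have "(\<lambda>n. ennreal ((ball_average h (u n) x)\<^sup>2)) \<longlonglongrightarrow> ennreal (0\<^sup>2)"
        by (intro tendsto_ennrealI tendsto_intros weakly_null_ball_average_tendsto_0[OF h weak])
      then show ?thesis using True by simp
    qed simp
    then show "AE x in lborel. (\<lambda>n. ennreal ((ball_average h (u n) x)\<^sup>2) * indicator (cball 0 R) x) \<longlonglongrightarrow> 0"
      by simp
  qed measurable
  then show ?thesis by simp
qed

lemma nn_integral_sq_le_ball_average: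
  fixes u :: "'a::euclidean_space \<Rightarrow> real"
  assumes [measurable]: "u \<in> borel_measurable borel"
  shows "(\<integral>\<^sup>+x. ennreal ((u x)\<^sup>2) \<partial>lborel)
    \<le> 2 * (\<integral>\<^sup>+x\<in>cball 0 R. ennreal ((ball_average h u x)\<^sup>2) \<partial>lborel)
      + 2 * (\<integral>\<^sup>+x. ennreal ((ball_average h u x - u x)\<^sup>2) \<partial>lborel)
      + (\<integral>\<^sup>+x\<in>- cball 0 R. ennreal ((u x)\<^sup>2) \<partial>lborel)"
proof -
  have "ennreal ((u x)\<^sup>2) \<le> 2 * (ennreal ((ball_average h u x)\<^sup>2) * indicator (cball 0 R) x)
      + 2 * ennreal ((ball_average h u x - u x)\<^sup>2) + ennreal ((u x)\<^sup>2) * indicator (- cball 0 R) x" for x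
  proof (cases "x \<in> cball 0 R")
    case True
    have "0 \<le> (2 * ball_average h u x - u x)\<^sup>2" by simp
    also have "\<dots> = 2 * (ball_average h u x)\<^sup>2 + 2 * (ball_average h u x - u x)\<^sup>2 - (u x)\<^sup>2"
      by (simp add: power2_eq_square algebra_simps)
    finally have "ennreal ((u x)\<^sup>2)
        \<le> ennreal (2 * (ball_average h u x)\<^sup>2 + 2 * (ball_average h u x - u x)\<^sup>2)"
      by (intro ennreal_leI) simp
    then show ?thesis using True by (simp add: ennreal_mult')
  qed simp
  then have "(\<integral>\<^sup>+x. ennreal ((u x)\<^sup>2) \<partial>lborel)
      \<le> (\<integral>\<^sup>+x. 2 * (ennreal ((ball_average h u x)\<^sup>2) * indicator (cball 0 R) x)
        + 2 * ennreal ((ball_average h u x - u x)\<^sup>2)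
        + ennreal ((u x)\<^sup>2) * indicator (- cball 0 R) x \<partial>lborel)"
    by (intro nn_integral_mono)
  then show ?thesis by (simp add: nn_integral_add nn_integral_cmult)
qed

text \<open>Weak convergence makes the ball averages vanish locally; equicontinuity under translations and
  tightness control what the averages miss.\<close>

theorem weakly_null_imp_L2_null:
  fixes u :: "nat \<Rightarrow> 'a::euclidean_space \<Rightarrow> real"
  assumes u: "\<And>n. square_integrable lborel (u n)"
    and bound: "\<And>n. (\<integral>\<^sup>+x. ennreal ((u n x)\<^sup>2) \<partial>lborel) \<le> ennreal K"
    and weak: "\<And>f. square_integrable lborel f \<Longrightarrow> (\<lambda>n. \<integral>x. u n x * f x \<partial>lborel) \<longlonglongrightarrow> 0"
    and equicontinuous: "\<And>e. e > 0 \<Longrightarrow>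
      \<exists>h>0. \<forall>n z. norm z \<le> h \<longrightarrow> (\<integral>\<^sup>+x. ennreal ((u n (z + x) - u n x)\<^sup>2) \<partial>lborel) \<le> ennreal e"
    and tight: "\<And>e. e > 0 \<Longrightarrow> \<exists>R. \<forall>n. (\<integral>\<^sup>+x\<in>- cball 0 R. ennreal ((u n x)\<^sup>2) \<partial>lborel) \<le> ennreal e"
  shows "(\<lambda>n. \<integral>\<^sup>+x. ennreal ((u n x)\<^sup>2) \<partial>lborel) \<longlonglongrightarrow> 0"
proof (rule tendsto_zero_ennreal)
  fix r :: real assume "r > 0"
  define e where "e = r / 6"
  have "e > 0" using \<open>r > 0\<close> by (simp add: e_def)
  have u_measurable: "u n \<in> borel_measurable borel" for n
    using borel_measurable_square_integrable[OF u] by simp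
  obtain h where "h > 0" and translation:
      "\<And>n z. norm z \<le> h \<Longrightarrow> (\<integral>\<^sup>+x. ennreal ((u n (z + x) - u n x)\<^sup>2) \<partial>lborel) \<le> ennreal e"
    using equicontinuous[OF \<open>e > 0\<close>] by blast
  obtain R where tail: "\<And>n. (\<integral>\<^sup>+x\<in>- cball 0 R. ennreal ((u n x)\<^sup>2) \<partial>lborel) \<le> ennreal e"
    using tight[OF \<open>e > 0\<close>] by blast
  have "(\<lambda>n. \<integral>\<^sup>+x\<in>cball 0 R. ennreal ((ball_average h (u n) x)\<^sup>2) \<partial>lborel) \<longlonglongrightarrow> 0"
    by (rule weakly_null_ball_average_L2_null_on_cball[OF u_measurable \<open>h > 0\<close> bound weak])
  then have "\<forall>\<^sub>F n in sequentially.
      (\<integral>\<^sup>+x\<in>cball 0 R. ennreal ((ball_average h (u n) x)\<^sup>2) \<partial>lborel) < ennreal e"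
    using \<open>e > 0\<close> by (intro order_tendstoD(2)) auto
  then show "\<forall>\<^sub>F n in sequentially. (\<integral>\<^sup>+x. ennreal ((u n x)\<^sup>2) \<partial>lborel) < ennreal r"
  proof eventually_elim
    case (elim n)
    note nn_integral_sq_le_ball_average[OF u_measurable, of n h R]
    also have "2 * (\<integral>\<^sup>+x\<in>cball 0 R. ennreal ((ball_average h (u n) x)\<^sup>2) \<partial>lborel)
        + 2 * (\<integral>\<^sup>+x. ennreal ((ball_average h (u n) x - u n x)\<^sup>2) \<partial>lborel)
        + (\<integral>\<^sup>+x\<in>- cball 0 R. ennreal ((u n x)\<^sup>2) \<partial>lborel) \<le> 2 * ennreal e + 2 * ennreal e + ennreal e"
      by (intro add_mono mult_left_mono tail less_imp_le[OF elim]
          nn_integral_ball_average_diff_sq_le[OF u \<open>h > 0\<close> translation]) auto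
    also have "2 * ennreal e = ennreal (2 * e)" using \<open>e > 0\<close> by (simp add: ennreal_mult')
    also have "ennreal (2 * e) + ennreal (2 * e) + ennreal e = ennreal (5 * e)"
      using \<open>e > 0\<close> by (simp flip: ennreal_plus)
    also have "\<dots> < ennreal r"
      using \<open>r > 0\<close> by (simp add: e_def ennreal_lessI)
    finally show ?case .
  qed
qed

section \<open>The compact embedding into \<open>L\<^sup>2\<close>\<close>

lemma (in positive_potential) H1V_translation:
  assumes v: "v \<in> H1V V"
  shows "(\<integral>\<^sup>+x. ennreal ((fst v (z + x) - fst v x)\<^sup>2) \<partial>lborel) \<le> ennreal ((norm z)\<^sup>2 * normV_sq V v)"
proof -
  obtain \<phi> where \<phi>: "\<And>n. \<phi> n \<in> test_fun"
    and lim: "(\<lambda>n. normV_sq V (test_pair (\<phi> n))) \<longlonglongrightarrow> normV_sq V v"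
    and lim_AE: "AE x in lborel. (\<lambda>n. \<phi> n x) \<longlonglongrightarrow> fst v x"
    using H1V_test_sequence[OF v] by blast
  note [measurable] = borel_measurable_test_fun(1)[OF \<phi>]
  show ?thesis
  proof (rule nn_integral_le_of_AE_tendsto)
    show "AE x in lborel. (\<lambda>n. (\<phi> n (z + x) - \<phi> n x)\<^sup>2) \<longlonglongrightarrow> (fst v (z + x) - fst v x)\<^sup>2"
      using lim_AE AE_lborel_shift[OF lim_AE, of z] by eventually_elim (intro tendsto_intros)
    show "(\<lambda>n. ennreal ((norm z)\<^sup>2 * normV_sq V (test_pair (\<phi> n))))
        \<longlonglongrightarrow> ennreal ((norm z)\<^sup>2 * normV_sq V v)"
      by (intro tendsto_ennrealI tendsto_intros lim)
    fix n
    have "(\<integral>\<^sup>+x. ennreal ((\<phi> n (z + x) - \<phi> n x)\<^sup>2) \<partial>lborel)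
        \<le> ennreal ((norm z)\<^sup>2) * (\<integral>\<^sup>+x. ennreal ((norm (grad (\<phi> n) x))\<^sup>2) \<partial>lborel)"
      by (rule nn_integral_translation_diff_sq_le[OF test_fun_has_derivative[OF \<phi>]
            test_fun_continuous_grad[OF \<phi>]])
    also have "\<dots> \<le> ennreal ((norm z)\<^sup>2)
        * (\<integral>\<^sup>+x. ennreal ((norm (weighted_pair V (test_pair (\<phi> n)) x))\<^sup>2) \<partial>lborel)"
      by (intro mult_left_mono nn_integral_mono ennreal_leI) (auto simp: norm_weighted_pair)
    also have "\<dots> = ennreal ((norm z)\<^sup>2 * normV_sq V (test_pair (\<phi> n)))"
      using \<phi> by (simp add: nn_integral_weighted_pair test_pair_in_H1V ennreal_mult normV_sq_nonneg)
    finally show "(\<integral>\<^sup>+x. ennreal ((\<phi> n (z + x) - \<phi> n x)\<^sup>2) \<partial>lborel)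
        \<le> ennreal ((norm z)\<^sup>2 * normV_sq V (test_pair (\<phi> n)))" .
  qed measurable
qed

locale coercive_potential = positive_potential +
  assumes V_coercive: "filterlim V at_top at_infinity"
begin

lemma V_bounded_below:
  obtains \<delta> where "\<delta> > 0" "\<And>x. \<delta> \<le> V x"
proof -
  obtain R where R: "\<And>x. norm x \<ge> R \<Longrightarrow> 1 \<le> V x"
    using V_coercive unfolding filterlim_at_top eventually_at_infinity by blast
  have "\<exists>x0\<in>cball 0 \<bar>R\<bar>. \<forall>x\<in>cball 0 \<bar>R\<bar>. V x0 \<le> V x"
    by (rule continuous_attains_inf) (auto intro: continuous_on_subset[OF V_continuous])
  then obtain x0 where "\<forall>x\<in>cball 0 \<bar>R\<bar>. V x0 \<le> V x" by blast
  then have x0: "V x0 \<le> V x" if "norm x \<le> \<bar>R\<bar>" for x using that by simp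
  have "min 1 (V x0) \<le> V x" for x
    using R[of x] x0[of x] by (cases "norm x \<le> \<bar>R\<bar>") (auto simp: min_le_iff_disj)
  then show thesis using V_pos[of x0] by (intro that[of "min 1 (V x0)"]) auto
qed

lemma nn_integral_fst_sq_le:
  assumes v: "v \<in> H1V V" and "L > 0" and V_ge: "\<And>x. x \<in> A \<Longrightarrow> L \<le> V x"
  shows "(\<integral>\<^sup>+x\<in>A. ennreal ((fst v x)\<^sup>2) \<partial>lborel) \<le> ennreal (normV_sq V v / L)"
proof -
  have "ennreal ((fst v x)\<^sup>2) * indicator A x
      \<le> ennreal (1 / L) * ennreal ((norm (weighted_pair V v x))\<^sup>2)" for x
  proof (cases "x \<in> A")
    case True
    have "L * (fst v x)\<^sup>2 \<le> V x * (fst v x)\<^sup>2" using V_ge[OF True] by (intro mult_right_mono) auto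
    also have "\<dots> \<le> (norm (weighted_pair V v x))\<^sup>2" by (simp add: norm_weighted_pair)
    finally have "(fst v x)\<^sup>2 \<le> (1 / L) * (norm (weighted_pair V v x))\<^sup>2"
      using \<open>L > 0\<close> by (simp add: field_simps)
    from ennreal_leI[OF this] show ?thesis
      using True \<open>L > 0\<close> by (simp add: ennreal_mult' del: times_divide_eq_left)
  qed simp
  then have "(\<integral>\<^sup>+x\<in>A. ennreal ((fst v x)\<^sup>2) \<partial>lborel)
      \<le> (\<integral>\<^sup>+x. ennreal (1 / L) * ennreal ((norm (weighted_pair V v x))\<^sup>2) \<partial>lborel)"
    by (rule nn_integral_mono)
  also have "\<dots> = ennreal (1 / L) * ennreal (normV_sq V v)"
    using borel_measurable_square_integrable[OF square_integrable_H1V[OF v]]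
    by (simp add: nn_integral_cmult nn_integral_weighted_pair[OF v])
  also have "\<dots> = ennreal (normV_sq V v / L)"
    using \<open>L > 0\<close> normV_sq_nonneg[OF v] by (simp flip: ennreal_mult)
  finally show ?thesis .
qed

lemma square_integrable_fst_H1V:
  assumes v: "v \<in> H1V V"
  shows "square_integrable lborel (fst v)"
proof -
  obtain \<delta> where "\<delta> > 0" "\<And>x. \<delta> \<le> V x" using V_bounded_below by blast
  from nn_integral_fst_sq_le[OF v this, of UNIV] show ?thesis
    using borel_measurable_H1V(1)[OF v]
    by (auto simp: square_integrable_iff_nn_integral intro: le_less_trans)
qed

lemma square_integrable_over_sqrtV:
  assumes f: "square_integrable lborel f"
  shows "square_integrable lborel (\<lambda>x. (f x / sqrt (V x), 0 :: pt))"
proof -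
  obtain \<delta> where \<delta>: "\<delta> > 0" "\<And>x. \<delta> \<le> V x" using V_bounded_below by blast
  have [measurable]: "f \<in> borel_measurable borel" using borel_measurable_square_integrable[OF f] by simp
  have "integrable lborel (\<lambda>x. (f x)\<^sup>2 / V x)"
  proof (rule Bochner_Integration.integrable_bound)
    show "integrable lborel (\<lambda>x. (f x)\<^sup>2 / \<delta>)" using f by (simp add: square_integrable_def)
    show "AE x in lborel. norm ((f x)\<^sup>2 / V x) \<le> norm ((f x)\<^sup>2 / \<delta>)"
      using \<delta> V_pos by (intro AE_I2) (simp add: divide_left_mono)
  qed measurable
  moreover have "(\<lambda>x. (f x / sqrt (V x), 0 :: pt)) \<in> borel_measurable lborel"
    by (intro borel_measurable_Pair) measurable
  ultimately show ?thesis by (simp add: square_integrable_def norm_Pair power_divide)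
qed

lemma weak_conv_V_imp_weak_L2:
  assumes s: "\<And>n. s n \<in> H1V V" and v: "v \<in> H1V V" and weak: "weak_conv_V V s v"
    and f: "square_integrable lborel f"
  shows "(\<lambda>n. \<integral>x. fst (s n) x * f x \<partial>lborel) \<longlonglongrightarrow> (\<integral>x. fst v x * f x \<partial>lborel)"
proof -
  let ?w = "\<lambda>x. (f x / sqrt (V x), 0 :: pt)"
  have "sqrt (V x) \<noteq> 0" for x using V_pos[of x] by simp
  then have "weighted_pair V u x \<bullet> ?w x = fst u x * f x" for u x by (simp add: weighted_pair_def)
  then have "L2_pair u \<bullet> L2_of ?w = (\<integral>x. fst u x * f x \<partial>lborel)" if "u \<in> H1V V" for u
    unfolding L2_pair_def using that f
    by (simp add: inner_L2_of square_integrable_H1V square_integrable_over_sqrtV del: inner_prod_def)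
  then show ?thesis
    using weak_conv_V_iff[OF s v, THEN iffD1, OF weak, THEN spec, of "L2_of ?w"] s v by simp
qed

lemma H1V_bounded_equicontinuous:
  assumes s: "\<And>n. s n \<in> H1V V" and bound: "\<And>n. normV_sq V (s n) \<le> K" and "e > 0"
  shows "\<exists>h>0. \<forall>n z. norm z \<le> h \<longrightarrow>
    (\<integral>\<^sup>+x. ennreal ((fst (s n) (z + x) - fst (s n) x)\<^sup>2) \<partial>lborel) \<le> ennreal e"
proof (intro exI[of _ "sqrt (e / (K + 1))"] conjI allI impI)
  have "0 \<le> K" using normV_sq_nonneg[OF s] bound order.trans by blast
  then show "sqrt (e / (K + 1)) > 0" using \<open>e > 0\<close> by simp
  fix n and z :: pt assume "norm z \<le> sqrt (e / (K + 1))"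
  then have "(norm z)\<^sup>2 \<le> e / (K + 1)"
    using \<open>e > 0\<close> \<open>0 \<le> K\<close> power_mono[of "norm z" "sqrt (e / (K + 1))" 2] by simp
  then have "(norm z)\<^sup>2 * normV_sq V (s n) \<le> e / (K + 1) * (K + 1)"
    using bound[of n] normV_sq_nonneg[OF s[of n]] \<open>e > 0\<close> \<open>0 \<le> K\<close> by (intro mult_mono) auto
  also have "\<dots> = e" using \<open>0 \<le> K\<close> by simp
  finally show "(\<integral>\<^sup>+x. ennreal ((fst (s n) (z + x) - fst (s n) x)\<^sup>2) \<partial>lborel) \<le> ennreal e"
    using H1V_translation[OF s] by (rule order.trans[OF _ ennreal_leI, rotated])
qed

lemma H1V_bounded_tight:
  assumes s: "\<And>n. s n \<in> H1V V" and bound: "\<And>n. normV_sq V (s n) \<le> K" and "e > 0"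
  shows "\<exists>R. \<forall>n. (\<integral>\<^sup>+x\<in>- cball 0 R. ennreal ((fst (s n) x)\<^sup>2) \<partial>lborel) \<le> ennreal e"
proof -
  have "0 \<le> K" using normV_sq_nonneg[OF s] bound order.trans by blast
  define L where "L = (K + 1) / e"
  have "L > 0" using \<open>e > 0\<close> \<open>0 \<le> K\<close> by (simp add: L_def)
  obtain R where R: "\<And>x. norm x \<ge> R \<Longrightarrow> L \<le> V x"
    using V_coercive unfolding filterlim_at_top eventually_at_infinity by blast
  have "(\<integral>\<^sup>+x\<in>- cball 0 R. ennreal ((fst (s n) x)\<^sup>2) \<partial>lborel) \<le> ennreal e" for n
  proof -
    have "(\<integral>\<^sup>+x\<in>- cball 0 R. ennreal ((fst (s n) x)\<^sup>2) \<partial>lborel) \<le> ennreal (normV_sq V (s n) / L)"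
      using R by (intro nn_integral_fst_sq_le s \<open>L > 0\<close>) auto
    also have "\<dots> \<le> ennreal ((K + 1) / L)"
      using bound[of n] \<open>L > 0\<close> by (intro ennreal_leI divide_right_mono) auto
    also have "(K + 1) / L = e" using \<open>e > 0\<close> \<open>0 \<le> K\<close> by (simp add: L_def)
    finally show ?thesis .
  qed
  then show ?thesis by blast
qed

lemma H1V_weakly_null_imp_L2_null:
  assumes s: "\<And>n. s n \<in> H1V V" and bound: "\<And>n. normV_sq V (s n) \<le> K"
    and weak: "\<And>f. square_integrable lborel f \<Longrightarrow> (\<lambda>n. \<integral>x. fst (s n) x * f x \<partial>lborel) \<longlonglongrightarrow> 0"
  shows "(\<lambda>n. \<integral>\<^sup>+x. ennreal ((fst (s n) x)\<^sup>2) \<partial>lborel) \<longlonglongrightarrow> 0"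
proof -
  obtain \<delta> where \<delta>: "\<delta> > 0" "\<And>x. \<delta> \<le> V x" using V_bounded_below by blast
  have "(\<integral>\<^sup>+x. ennreal ((fst (s n) x)\<^sup>2) \<partial>lborel) \<le> ennreal (K / \<delta>)" for n
    using nn_integral_fst_sq_le[OF s[of n] \<delta>, of UNIV] bound[of n] \<delta>(1)
    by (auto elim!: order.trans intro!: ennreal_leI divide_right_mono)
  then show ?thesis
    by (rule weakly_null_imp_L2_null[OF square_integrable_fst_H1V[OF s] _ weak
          H1V_bounded_equicontinuous[OF s bound] H1V_bounded_tight[OF s bound]])
qed

theorem H1V_compactly_embedded_in_L2:
  assumes s: "\<And>n. s n \<in> H1V V" and bound: "\<And>n. normV_sq V (s n) \<le> K"
    and v: "v \<in> H1V V" and weak: "weak_conv_V V s v"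
  shows "(\<lambda>n. L2_sq (\<lambda>x. fst (s n) x - fst v x)) \<longlonglongrightarrow> 0"
proof -
  let ?d = "\<lambda>n. pair_diff (s n) v"
  have diff_H1V: "?d n \<in> H1V V" for n by (rule pair_diff_in_H1V[OF s v])
  have "(\<lambda>n. \<integral>\<^sup>+x. ennreal ((fst (?d n) x)\<^sup>2) \<partial>lborel) \<longlonglongrightarrow> 0"
  proof (rule H1V_weakly_null_imp_L2_null[OF diff_H1V])
    show "normV_sq V (?d n) \<le> (sqrt K + norm (L2_pair v))\<^sup>2" for n
    proof -
      have "norm (L2_pair (s n)) \<le> sqrt K"
        using bound[of n] by (simp add: normV_sq_eq_norm[OF s] real_le_rsqrt)
      then have "norm (L2_pair (?d n)) \<le> sqrt K + norm (L2_pair v)"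
        using norm_triangle_ineq4[of "L2_pair (s n)" "L2_pair v"] by (simp add: L2_pair_diff[OF s v])
      then show ?thesis unfolding normV_sq_eq_norm[OF diff_H1V] by (intro power_mono) auto
    qed
    fix f :: "pt \<Rightarrow> real" assume f: "square_integrable lborel f"
    have "integrable lborel (\<lambda>x. fst w x * f x)" if "w \<in> H1V V" for w
      using integrable_inner_square_integrable[OF square_integrable_fst_H1V[OF that] f] by simp
    then have "(\<integral>x. fst (?d n) x * f x \<partial>lborel)
        = (\<integral>x. fst (s n) x * f x \<partial>lborel) - (\<integral>x. fst v x * f x \<partial>lborel)" for n
      using s v by (simp add: left_diff_distrib)
    then show "(\<lambda>n. \<integral>x. fst (?d n) x * f x \<partial>lborel) \<longlonglongrightarrow> 0"
      using LIM_zero[OF weak_conv_V_imp_weak_L2[OF s v weak f]] by simp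
  qed
  moreover have "(\<integral>\<^sup>+x. ennreal ((fst (?d n) x)\<^sup>2) \<partial>lborel) = ennreal (L2_sq (fst (?d n)))" for n
    using square_integrable_fst_H1V[OF diff_H1V] unfolding L2_sq_def
    by (intro nn_integral_eq_integral) (auto simp: square_integrable_def)
  ultimately have "(\<lambda>n. ennreal (L2_sq (fst (?d n)))) \<longlonglongrightarrow> ennreal 0" by simp
  then show ?thesis by (subst (asm) tendsto_ennreal_iff) (auto simp: L2_sq_def)
qed

corollary weak_limit_nonzero_if_L2_bounded_below:
  assumes s: "\<And>n. s n \<in> H1V V" and bound: "\<And>n. normV_sq V (s n) \<le> K"
    and v: "v \<in> H1V V" and weak: "weak_conv_V V s v"
    and "\<eta> > 0" and below: "\<And>n. \<eta> \<le> L2_sq (fst (s n))"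
  shows "nonzeroV v"
  unfolding nonzeroV_def
proof
  assume zero: "AE x in lborel. fst v x = 0"
  note [measurable] = borel_measurable_H1V(1)[OF s] borel_measurable_H1V(1)[OF v]
  have "L2_sq (\<lambda>x. fst (s n) x - fst v x) = L2_sq (fst (s n))" for n
    unfolding L2_sq_def using zero by (intro integral_cong_AE) (auto elim: eventually_mono)
  then have "(\<lambda>n. L2_sq (fst (s n))) \<longlonglongrightarrow> 0"
    using H1V_compactly_embedded_in_L2[OF s bound v weak] by simp
  then have "\<eta> \<le> 0" by (rule LIMSEQ_le_const) (use below in blast)
  then show False using \<open>\<eta> > 0\<close> by simp
qed

end

section \<open>Minimising sequences on the Nehari set\<close>

lemma Ifun_Nehari:
  assumes "p > 1" "v \<in> Nehari p V"
  shows "Ifun p V v = (1/2 - 1 / (p + 3)) * normV_sq V v"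
proof -
  have "1 / (p + 1) * L2_sq (fst v) * nonlin p V (fst v) = 1 / (p + 3) * normV_sq V v"
    using assms by (simp add: Nehari_def)
  then show ?thesis by (simp add: Ifun_def left_diff_distrib)
qed

lemma Nehari_bounded_if_Ifun_convergent:
  assumes p: "p > 1" and u: "\<And>n. u n \<in> Nehari p V" and conv: "convergent (\<lambda>n. Ifun p V (u n))"
  obtains K where "\<And>n. normV_sq V (u n) \<le> K"
proof -
  have coeff_pos: "1/2 - 1 / (p + 3) > 0" using p by (simp add: field_simps)
  obtain B where B: "\<And>n. \<bar>Ifun p V (u n)\<bar> \<le> B"
    using convergent_imp_Bseq[OF conv] by (auto simp: Bseq_def)
  have "normV_sq V (u n) \<le> B / (1/2 - 1 / (p + 3))" for n
    using B[of n] coeff_pos by (simp add: Ifun_Nehari[OF p u] pos_le_divide_eq mult.commute)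
  then show thesis by (rule that)
qed

lemma (in C1_potential) Nehari_L2_lower_bound:
  assumes p: "p > 1" and "K \<ge> 0"
  obtains \<eta> where "\<eta> > 0" "\<And>v. v \<in> Nehari p V \<Longrightarrow> normV_sq V v \<le> K \<Longrightarrow> \<eta> \<le> L2_sq (fst v)"
proof -
  obtain D where D: "D > 0" "\<And>v. v \<in> H1V V \<Longrightarrow> normV_sq V v \<le> K \<Longrightarrow> nonlin p V (fst v) \<le> D * normV_sq V v"
    using nonlin_bound[of p K] p \<open>K \<ge> 0\<close> by (metis less_imp_le)
  define A where "A = (p + 3) / (p + 1) * D"
  have "A > 0" using p D(1) by (simp add: A_def)
  have "1 / A \<le> L2_sq (fst v)" if v: "v \<in> Nehari p V" and bounded: "normV_sq V v \<le> K" for v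
  proof -
    have v_H1V: "v \<in> H1V V" and "nonzeroV v"
      and Nehari_eq: "normV_sq V v = (p + 3) / (p + 1) * L2_sq (fst v) * nonlin p V (fst v)"
      using v by (simp_all add: Nehari_def)
    then have pos: "normV_sq V v > 0" by (intro normV_sq_pos)
    have "normV_sq V v \<le> (p + 3) / (p + 1) * L2_sq (fst v) * (D * normV_sq V v)"
      using D(2)[OF v_H1V bounded] p by (subst Nehari_eq, intro mult_left_mono) (auto simp: L2_sq_def)
    then have "1 * normV_sq V v \<le> (A * L2_sq (fst v)) * normV_sq V v" by (simp add: A_def ac_simps)
    then have "1 \<le> A * L2_sq (fst v)" using pos by (simp only: mult_le_cancel_right_pos)
    then show ?thesis using \<open>A > 0\<close> by (simp add: field_simps)
  qed
  then show thesis using \<open>A > 0\<close> by (intro that[of "1 / A"]) auto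
qed

theorem lemma3p5:
  fixes p :: real and V :: "pt \<Rightarrow> real" and DV :: "pt \<Rightarrow> pt"
    and u :: "nat \<Rightarrow> (pt \<Rightarrow> real) \<times> (pt \<Rightarrow> pt)"
  assumes p: "p > 1"
    and V_C1: "\<forall>x. (V has_derivative (\<lambda>h. DV x \<bullet> h)) (at x)" "continuous_on UNIV DV"
    and V_pos: "\<forall>x. V x > 0"
    and V_coercive: "filterlim V at_top at_infinity"
    and V_grad: "\<exists>C>0. AE x in lborel. norm (DV x) \<le> C * V x powr (3/2)"
    and u_N: "\<forall>n. u n \<in> Nehari p V"
    and u_min: "(\<lambda>n. Ifun p V (u n)) \<longlonglongrightarrow> Inf (Ifun p V ` Nehari p V)"
  shows "\<exists>r u0. strict_mono r \<and> u0 \<in> H1V V \<and> nonzeroV u0 \<and> weak_conv_V V (u \<circ> r) u0"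
proof -
  obtain C where C: "C > 0" "AE x in lborel. norm (DV x) \<le> C * V x powr (3/2)" using V_grad by blast
  have "continuous_on UNIV V"
    using V_C1(1) by (intro continuous_at_imp_continuous_on ballI has_derivative_continuous) blast
  then interpret positive_potential V using V_pos by unfold_locales auto
  interpret C1_potential V DV C using V_C1 C by unfold_locales auto
  interpret coercive_potential V using V_coercive by unfold_locales
  have u_H1V: "u n \<in> H1V V" for n using u_N by (simp add: Nehari_def)
  obtain K where K: "\<And>n. normV_sq V (u n) \<le> K"
    using Nehari_bounded_if_Ifun_convergent[OF p] u_N u_min convergentI by blast
  obtain r u0 where r: "strict_mono r" and u0: "u0 \<in> H1V V" and weak: "weak_conv_V V (u \<circ> r) u0"
    by (rule H1V_weakly_sequentially_compact[of u K, OF u_H1V K])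
  have "0 \<le> K" using normV_sq_nonneg[OF u_H1V] K order.trans by blast
  then obtain \<eta> where \<eta>: "\<eta> > 0"
      "\<And>v. v \<in> Nehari p V \<Longrightarrow> normV_sq V v \<le> K \<Longrightarrow> \<eta> \<le> L2_sq (fst v)"
    by (rule Nehari_L2_lower_bound[OF p]) blast
  have "nonzeroV u0"
    using weak_limit_nonzero_if_L2_bounded_below[where s = "u \<circ> r" and K = K, OF _ _ u0 weak \<eta>(1)]
      u_H1V K \<eta>(2) u_N by simp
  then show ?thesis using r u0 weak by blast
qed

end
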